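(* For any $u\in L^2_a(\mu_{\mathbb{T}},H_{\mathbb{T}})$, the pushforward ${\tau_u}_\star\mu_{\mathbb{T}}$ of $\mu_{\mathbb{T}}$ by $\tau_u:\omega\in C_{\mathbb{T}}\mapsto\omega+u(\omega)\in C_{\mathbb{T}}$ is absolutely continuous with respect to the sampled Wiener measure $\mu_{\mathbb{T}}$. Moreover, if $u\in L^\infty_a(\mu_{\mathbb{T}},H_{\mathbb{T}})$, then ${\tau_u}_\star\mu_{\mathbb{T}}\sim\mu_{\mathbb{T}}$, i.e. both probability measures are equivalent.
   Context: $\mathbb{T}$ is a closed subset of $\mathbb{R}$ with $\{0,1\}\subset\mathbb{T}\subset[0,1]$; for an interval $I\subset[0,1]$, $I_{\mathbb{T}}:=I\cap\mathbb{T}$. Let $\bar\rho:[0,1]\to\mathbb{T}$ be $\bar\rho(t):=\sup\{v\in\mathbb{T}:v<t\}$ for $t\in(0,1]$ and $\bar\rho(0):=0$; $\lambda_\Delta:=\bar\rho_\star\lambda$ is the pushforward to $(\mathbb{T},\mathcal{B}(\mathbb{T}))$ of Lebesgue measure $\lambda$ on $[0,1]$. A point $t\in\mathbb{T}\setminus\{1\}$ is right-scattered if $\inf\{v\in\mathbb{T}:v>t\}>t$; $\mathbb{T}_{rs}$ is the set of right-scattered points. $C_{\mathbb{T}}$ is the Banach space of continuous $\omega:\mathbb{T}\to\mathbb{R}$ with $\omega(0)=0$, with the sup norm; $W_t(\omega):=\omega(t)$ is evaluation. The sampled Wiener measure $\mu_{\mathbb{T}}$ is the law on $C_{\mathbb{T}}$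 of $(B_t)_{t\in\mathbb{T}}$, where $(B_t)_{t\in[0,1]}$ is a standard Brownian motion started at $0$. $\mathcal{F}_t^{\mu_{\mathbb{T}}}$ is the smallest $\sigma$-field containing $\sigma(W_s:s\in[0,t]_{\mathbb{T}})$ and all $\mu_{\mathbb{T}}$-negligible sets of the $\mu_{\mathbb{T}}$-completed Borel $\sigma$-field. $H_{\mathbb{T}}$ is the separable Hilbert space of $h\in C_{\mathbb{T}}$ of the form $h(t)=\int_{[0,t)_{\mathbb{T}}}h^\Delta(s)\lambda_\Delta(ds)$, $t\in\mathbb{T}$, with $h^\Delta\in L^2(\lambda_\Delta)$, with scalar product $\langle h,k\rangle_{H_{\mathbb{T}}}=\int_{\mathbb{T}}h^\Delta k^\Delta\,d\lambda_\Delta$. $L^2(\mu_{\mathbb{T}},H_{\mathbb{T}})$ is the Hilbert space of $\mu_{\mathbb{T}}$-equivalence classes of Borel measurable $u:C_{\mathbb{T}}\to C_{\mathbb{T}}$ with $\int\|u(\omega)\|_{H_{\mathbb{T}}}^2\mu_{\mathbb{T}}(d\omega)<\infty$. $L^2_a(\mu_{\mathbb{T}},H_{\mathbb{T}})$ is the subset of those $u=\int_{[0,\cdot)_{\mathbb{T}}}u^\Delta_s\lambda_\Delta(ds)$ such that $u_t:=W_t\circ u$ is $\mathcal{F}_t^{\mu_{\mathbb{T}}}$-measurable for all $t\in\mathbb{T}$ and $u^\Delta_t$ is $\mathcal{F}_t^{\mu_{\mathbb{T}}}$-measurable for all $t\in\mathbb{T}_{rs}$. $L^\infty_a(\mu_{\mathbb{T}},H_{\mathbb{T}})$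 is the set of $h\in L^2_a(\mu_{\mathbb{T}},H_{\mathbb{T}})$ for which there is $c>0$ with $\|h\|_{H_{\mathbb{T}}}<c$ $\mu_{\mathbb{T}}$-a.s. *)

theory Defs
  imports "HOL-Probability.Probability"
begin

definition standard_brownian_motion :: "'a measure \<Rightarrow> (real \<Rightarrow> 'a \<Rightarrow> real) \<Rightarrow> bool" where
  "standard_brownian_motion M B \<longleftrightarrow>
     prob_space M \<and>
     (\<forall>t\<in>{0..1}. B t \<in> borel_measurable M) \<and>
     (\<forall>\<omega>\<in>space M. B 0 \<omega> = 0) \<and>
     (\<forall>\<omega>\<in>space M. continuous_on {0..1} (\<lambda>t. B t \<omega>)) \<and>
     (\<forall>s t. 0 \<le> s \<and> s < t \<and> t \<le> 1 \<longrightarrow>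
        distributed M lborel (\<lambda>\<omega>. B t \<omega> - B s \<omega>) (normal_density 0 (sqrt (t - s)))) \<and>
     (\<forall>(n::nat) (p::nat \<Rightarrow> real).
        (\<forall>i\<le>n. p i \<in> {0..1}) \<and> (\<forall>i<n. p i < p (Suc i)) \<longrightarrow>
        prob_space.indep_vars M (\<lambda>_. borel) (\<lambda>i \<omega>. B (p (Suc i)) \<omega> - B (p i) \<omega>) {..<n})"

text \<open>Throughout, \<open>T\<close> is a closed set with \<open>{0, 1} \<subseteq> T \<subseteq> {0..1}\<close>.\<close>

definition rho_bar :: "real set \<Rightarrow> real \<Rightarrow> real" where
  "rho_bar T t = (if t = 0 then 0 else Sup {v \<in> T. v < t})"

definition lambda_Delta :: "real set \<Rightarrow> real measure" where
  "lambda_Delta T = distr (restrict_space lborel {0..1}) (restrict_space borel T) (rho_bar T)"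

definition right_scattered :: "real set \<Rightarrow> real set" where
  "right_scattered T = {t \<in> T. t \<noteq> 1 \<and> Inf {v \<in> T. v > t} > t}"

text \<open>The elements of the library's \<open>cfunspace\<close> are extensional: paths on \<open>T\<close> are represented by
  functions on the reals that are \<open>undefined\<close> outside \<open>T\<close>. Its metric is the supremum distance.\<close>

definition CT_metric :: "real set \<Rightarrow> (real \<Rightarrow> real) metric" where
  "CT_metric T = submetric (cfunspace (top_of_set T) euclidean_metric) {\<omega>. \<omega> 0 = 0}"

definition CT :: "real set \<Rightarrow> (real \<Rightarrow> real) set" where
  "CT T = mspace (CT_metric T)"

definition borel_CT :: "real set \<Rightarrow> (real \<Rightarrow> real) measure" where
  "borel_CT T = sigma (CT T) {U. openin (mtopology_of (CT_metric T)) U}"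

definition W :: "real \<Rightarrow> (real \<Rightarrow> real) \<Rightarrow> real" where
  "W t \<omega> = \<omega> t"

text \<open>The law on the path space of a process \<open>B\<close> sampled at the times in \<open>T\<close>; it is the sampled
  Wiener measure when \<open>B\<close> is a standard Brownian motion.\<close>

definition sampled_law :: "real set \<Rightarrow> 'a measure \<Rightarrow> (real \<Rightarrow> 'a \<Rightarrow> real) \<Rightarrow> (real \<Rightarrow> real) measure" where
  "sampled_law T M B = distr M (borel_CT T) (\<lambda>\<omega>. \<lambda>t\<in>T. B t \<omega>)"

definition filt :: "real set \<Rightarrow> (real \<Rightarrow> real) measure \<Rightarrow> real \<Rightarrow> (real \<Rightarrow> real) measure" where
  "filt T \<mu> t = sigma (CT T)
     ({W s -` A \<inter> CT T | s A. s \<in> {0..t} \<inter> T \<and> A \<in> sets borel} \<union> null_sets (completion \<mu>))"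

definition L2_Delta :: "real set \<Rightarrow> (real \<Rightarrow> real) set" where
  "L2_Delta T = {g \<in> borel_measurable (lambda_Delta T). integrable (lambda_Delta T) (\<lambda>s. (g s)\<^sup>2)}"

definition has_delta_density :: "real set \<Rightarrow> (real \<Rightarrow> real) \<Rightarrow> (real \<Rightarrow> real) \<Rightarrow> bool" where
  "has_delta_density T h g \<longleftrightarrow>
     g \<in> L2_Delta T \<and> (\<forall>t\<in>T. h t = (LINT s:{0..<t} \<inter> T|lambda_Delta T. g s))"

definition HT :: "real set \<Rightarrow> (real \<Rightarrow> real) set" where
  "HT T = {h \<in> CT T. \<exists>g. has_delta_density T h g}"

text \<open>A representative of the class of densities of \<open>h\<close>. The density is unique almost everywhere for
  \<open>lambda_Delta T\<close>, hence unique at each right-scattered point, as these points are atoms.\<close>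

definition delta_density :: "real set \<Rightarrow> (real \<Rightarrow> real) \<Rightarrow> real \<Rightarrow> real" where
  "delta_density T h = (SOME g. has_delta_density T h g)"

definition HT_inner :: "real set \<Rightarrow> (real \<Rightarrow> real) \<Rightarrow> (real \<Rightarrow> real) \<Rightarrow> real" where
  "HT_inner T h k = (LINT s|lambda_Delta T. delta_density T h s * delta_density T k s)"

definition HT_norm :: "real set \<Rightarrow> (real \<Rightarrow> real) \<Rightarrow> real" where
  "HT_norm T h = sqrt (HT_inner T h h)"

text \<open>The members of these sets are representatives \<open>u\<close> of equivalence classes modulo \<open>\<mu>\<close>-null sets;
  finiteness of the integral of the squared \<open>HT\<close>-norm includes that almost all values of \<open>u\<close> lie in
  \<open>HT T\<close>, which is stated explicitly because \<open>HT_norm\<close> is arbitrary outside \<open>HT T\<close>.\<close>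

definition L2_HT :: "real set \<Rightarrow> (real \<Rightarrow> real) measure \<Rightarrow> ((real \<Rightarrow> real) \<Rightarrow> (real \<Rightarrow> real)) set" where
  "L2_HT T \<mu> = {u \<in> measurable (borel_CT T) (borel_CT T).
     (AE \<omega> in \<mu>. u \<omega> \<in> HT T) \<and>
     (\<integral>\<^sup>+ \<omega>. ennreal ((HT_norm T (u \<omega>))\<^sup>2) \<partial>\<mu>) < \<infinity>}"

definition L2a_HT :: "real set \<Rightarrow> (real \<Rightarrow> real) measure \<Rightarrow> ((real \<Rightarrow> real) \<Rightarrow> (real \<Rightarrow> real)) set" where
  "L2a_HT T \<mu> = {u \<in> L2_HT T \<mu>.
     (\<forall>t\<in>T. (\<lambda>\<omega>. W t (u \<omega>)) \<in> borel_measurable (filt T \<mu> t)) \<and>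
     (\<forall>t\<in>right_scattered T. (\<lambda>\<omega>. delta_density T (u \<omega>) t) \<in> borel_measurable (filt T \<mu> t))}"

definition Linfa_HT :: "real set \<Rightarrow> (real \<Rightarrow> real) measure \<Rightarrow> ((real \<Rightarrow> real) \<Rightarrow> (real \<Rightarrow> real)) set" where
  "Linfa_HT T \<mu> = {u \<in> L2a_HT T \<mu>. \<exists>c>0. AE \<omega> in \<mu>. HT_norm T (u \<omega>) < c}"

definition tau :: "real set \<Rightarrow> ((real \<Rightarrow> real) \<Rightarrow> (real \<Rightarrow> real)) \<Rightarrow> (real \<Rightarrow> real) \<Rightarrow> (real \<Rightarrow> real)" where
  "tau T u \<omega> = (\<lambda>t\<in>T. \<omega> t + u \<omega> t)"

end

theory Submission
  imports Defs
begin

text \<open>Delay the drift \<open>u\<close> by \<open>1/n\<close> and look at the shifted path along a finite partition of \<open>T\<close> that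
  contains the first \<open>n\<close> points of a dense sequence and whose intervals are gaps of \<open>T\<close> or shorter than
  \<open>1/n\<close>. The increments of the delayed drift are then predictable, so an elementary discrete Girsanov
  formula \<open>E (Z f(X)) = E f(W)\<close> holds with an explicit likelihood \<open>Z\<close>, whose energy is at most the squared
  norm of \<open>u\<close>. This gives \<open>E f(X) \<le> e + K E f(W)\<close> with \<open>K\<close> depending on \<open>e\<close> but not on \<open>n\<close>, and the same with
  \<open>X\<close> and \<open>W\<close> exchanged when the norm of \<open>u\<close> is bounded. For continuous \<open>f\<close> on the space of real
  sequences these inequalities survive \<open>n \<rightarrow> \<infinity>\<close>, and by regularity of Borel measures they imply absolute
  continuity.\<close>

section \<open>Absolute continuity from continuous test functions\<close>

text \<open>Absolute continuity is not stable under weak limits, but an inequality with an additive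
  error \<open>e\<close> and a constant uniform in \<open>n\<close> is. The error is unavoidable for
  square integrable \<open>u\<close>: the energy is controlled only in mean, and \<open>e\<close>
  absorbs the event of large energy, where no bound on the likelihood is available. The opposite
  inequality rests on a second moment of the likelihood, hence on an almost sure bound for the
  energy.

  The delay answers an obstacle: \<open>u\<close> is adapted, so its increment over an interval is
  in general known only at the right end point. A delay repairs this on short intervals but not
  across a gap of \<open>T\<close> that exceeds it. There the measurability of the density at
  right-scattered points takes over, which is why the partition has two kinds of intervals.

  Real sequences are the target because the values at a dense sequence of times determine a path and
  generate the Borel sets of the path space, while convergence of sequences is checked one
  coordinate at a time.\<close>

lemma absolutely_continuous_if_continuous_functions_dominated:
  fixes P Q :: "'a::{second_countable_topology, complete_space} measure"
  assumes P: "sets P = sets borel" "finite_measure P"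
    and Q: "sets Q = sets borel" "finite_measure Q"
    and dom: "\<And>e. e > 0 \<Longrightarrow> \<exists>K\<ge>0. \<forall>f :: 'a \<Rightarrow> real. continuous_on UNIV f \<and> (\<forall>x. 0 \<le> f x \<and> f x \<le> 1) \<longrightarrow>
                (LINT x|P. f x) \<le> e + K * (LINT x|Q. f x)"
  shows "absolutely_continuous Q P"
proof -
  interpret P: finite_measure P by fact
  interpret Q: finite_measure Q by fact
  have sP: "space P = UNIV" and sQ: "space Q = UNIV"
    using P(1) Q(1) by (metis sets_eq_imp_space_eq space_borel)+
  have opens: "measure P U \<le> e + K * measure Q U"
    if U: "open U" and K: "\<forall>f :: 'a \<Rightarrow> real. continuous_on UNIV f \<and> (\<forall>x. 0 \<le> f x \<and> f x \<le> 1) \<longrightarrow>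
                (LINT x|P. f x) \<le> e + K * (LINT x|Q. f x)" for U e K
  proof -
    \<comment> \<open>The functions \<open>g k\<close> are continuous and increase to the indicator
      of \<open>U\<close>. The case \<open>U = UNIV\<close> is separate because
      \<open>infdist x {}\<close> is 0.\<close>
    define g where "g k x = (if U = UNIV then 1 else min 1 (real k * infdist x (- U)))" for k :: nat and x
    have g_cont: "continuous_on UNIV (g k)" for k
      unfolding g_def by (cases "U = UNIV") (auto intro!: continuous_intros)
    have g_meas: "g k \<in> borel_measurable borel" for k
      by (rule borel_measurable_continuous_onI[OF g_cont])
    have g01: "0 \<le> g k x" "g k x \<le> 1" for k x
      unfolding g_def by (auto simp: infdist_nonneg)
    have g_lim: "(\<lambda>k. g k x) \<longlonglongrightarrow> indicator U x" for x
    proof (cases "U = UNIV \<or> x \<notin> U")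
      case True
      then show ?thesis by (cases "U = UNIV") (auto simp: g_def)
    next
      case False
      then have "infdist x (- U) > 0"
        using U infdist_pos_not_in_closed[of "- U" x] by auto
      moreover obtain n where "1 / infdist x (- U) < real n"
        using reals_Archimedean2 by blast
      ultimately have "1 \<le> real k * infdist x (- U)" if "n \<le> k" for k
        using that by (smt (verit, best) of_nat_le_iff pos_divide_less_eq mult_right_mono)
      then have "\<forall>\<^sub>F k in sequentially. 1 \<le> real k * infdist x (- U)"
        by (rule eventually_sequentiallyI)
      then have "\<forall>\<^sub>F k in sequentially. g k x = 1"
        by eventually_elim (auto simp: g_def)
      then show ?thesis using False by (auto intro: tendsto_eventually)
    qed
    have lim: "(\<lambda>k. LINT x|R. g k x) \<longlonglongrightarrow> measure R U"
      if R: "sets R = sets borel" "finite_measure R" for R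
    proof -
      interpret R: finite_measure R by fact
      have "(\<lambda>k. LINT x|R. g k x) \<longlonglongrightarrow> (LINT x|R. indicator U x)"
      proof (rule integral_dominated_convergence[where w = "\<lambda>_. 1"])
        show "g k \<in> borel_measurable R" for k
          using g_meas measurable_cong_sets[OF R(1) refl] by blast
        show "indicator U \<in> borel_measurable R"
          using U by (intro borel_measurable_indicator) (simp add: R)
      qed (use g_lim g01 in auto)
      then show ?thesis using sets_eq_imp_space_eq[OF R(1)] by simp
    qed
    show ?thesis
      by (rule LIMSEQ_le[OF lim[OF P] tendsto_add[OF tendsto_const tendsto_mult[OF tendsto_const lim[OF Q]]]])
         (use K g_cont g01 in auto)
  qed
  show ?thesis
    unfolding absolutely_continuous_def
  proof
    fix A assume A: "A \<in> null_sets Q"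
    then have Ab: "A \<in> sets borel" using Q by auto
    have "measure P A \<le> 2 * e" if e: "e > 0" for e :: real
    proof -
      obtain K where K: "K \<ge> 0" "\<forall>f :: 'a \<Rightarrow> real. continuous_on UNIV f \<and> (\<forall>x. 0 \<le> f x \<and> f x \<le> 1) \<longrightarrow>
                (LINT x|P. f x) \<le> e + K * (LINT x|Q. f x)"
        using dom[OF e] by blast
      have "(INF U \<in> {U. A \<subseteq> U \<and> open U}. emeasure Q U) = 0"
        using outer_regular[OF Q(1) _ Ab] A by (auto simp: Q.emeasure_eq_measure)
      \<comment> \<open>\<open>K\<close> depends on \<open>e\<close> alone and is fixed before
        \<open>U\<close>, so an open superset of \<open>A\<close> can be chosen with
        \<open>K\<close> times its mass at most \<open>e\<close>. The \<open>+ 1\<close> covers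
        \<open>K = 0\<close>.\<close>
      then have "(INF U \<in> {U. A \<subseteq> U \<and> open U}. emeasure Q U) < ennreal (e / (K + 1))"
        using e K by simp
      then obtain U where U: "A \<subseteq> U" "open U" "emeasure Q U < ennreal (e / (K + 1))"
        by (auto simp: INF_less_iff)
      have "measure Q U < e / (K + 1)"
        using U(3) e K by (simp add: Q.emeasure_eq_measure ennreal_less_iff)
      then have "K * measure Q U \<le> K * (e / (K + 1))"
        using K by (intro mult_left_mono) auto
      also have "\<dots> \<le> e" using K e by (simp add: field_simps)
      finally have "measure P U \<le> 2 * e" using opens[OF U(2) K(2)] by simp
      moreover have "measure P A \<le> measure P U"
        using U by (intro P.finite_measure_mono) (auto simp: P)
      ultimately show ?thesis by simp
    qed
    from this[of "measure P A / 4"] have "measure P A = 0"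
      using measure_nonneg[of P A] by (cases "measure P A = 0") (auto simp: field_simps)
    then show "A \<in> null_sets P" using Ab by (auto simp: P P.emeasure_eq_measure null_sets_def)
  qed
qed

section \<open>Discrete Girsanov formula\<close>

text \<open>Completing the square. The exponential is the one-step likelihood: weighting by it
  replaces the density at the innovation \<open>x\<close> by the density at the shifted innovation
  \<open>a + x\<close>.\<close>

lemma normal_density_exp_shift:
  assumes "v > 0"
  shows "exp (- (a * x / v + a\<^sup>2 / (2 * v))) * normal_density 0 (sqrt v) x
    = normal_density 0 (sqrt v) (a + x)"
proof -
  have "- (a * x / v + a\<^sup>2 / (2 * v)) + - (x\<^sup>2 / (2 * v)) = - ((a + x)\<^sup>2 / (2 * v))"
    using assms by (simp add: field_simps power2_eq_square)
  then show ?thesis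
    using assms by (simp add: normal_density_def exp_add[symmetric] mult.left_commute)
qed

text \<open>\<open>innovation\<close> packs independence from the past and the normal law into one
  product formula for the joint law of \<xi> and the whole \<omega>, seen through
  \<open>G i\<close>. Tonelli then replaces conditional expectations, even for an
  infinite-dimensional past.\<close>

locale gaussian_innovations = prob_space N for N :: "'a measure" +
  fixes G :: "nat \<Rightarrow> 'a measure" and \<xi> :: "nat \<Rightarrow> 'a \<Rightarrow> real" and v :: "nat \<Rightarrow> real" and m :: nat
  assumes space_G: "i \<le> m \<Longrightarrow> space (G i) = space N"
    and sets_G: "i \<le> m \<Longrightarrow> sets (G i) \<subseteq> sets N"
    and mono_G: "i \<le> j \<Longrightarrow> j \<le> m \<Longrightarrow> sets (G i) \<subseteq> sets (G j)"
    and \<xi>_G: "i < m \<Longrightarrow> \<xi> i \<in> borel_measurable (G (Suc i))"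
    and v_pos: "i < m \<Longrightarrow> 0 < v i"
    and innovation: "i < m \<Longrightarrow> distr N (G i \<Otimes>\<^sub>M borel) (\<lambda>\<omega>. (\<omega>, \<xi> i \<omega>)) =
      distr N (G i) (\<lambda>\<omega>. \<omega>) \<Otimes>\<^sub>M density lborel (normal_density 0 (sqrt (v i)))"
begin

lemma measurable_G_N:
  assumes "i \<le> m" and f: "f \<in> measurable (G i) S"
  shows "f \<in> measurable N S"
proof (rule measurableI)
  show "f \<omega> \<in> space S" if "\<omega> \<in> space N" for \<omega>
    using measurable_space[OF f, of \<omega>] that space_G[OF assms(1)] by simp
  show "f -` A \<inter> space N \<in> sets N" if "A \<in> sets S" for A
    using measurable_sets[OF f that] space_G[OF assms(1)] sets_G[OF assms(1)] by auto
qed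

lemma measurable_G_mono:
  assumes "i \<le> j" "j \<le> m" and f: "f \<in> measurable (G i) S"
  shows "f \<in> measurable (G j) S"
proof (rule measurableI)
  have sp: "space (G i) = space (G j)" using space_G assms(1,2) by simp
  show "f \<omega> \<in> space S" if "\<omega> \<in> space (G j)" for \<omega>
    using measurable_space[OF f, of \<omega>] that sp by simp
  show "f -` A \<inter> space (G j) \<in> sets (G j)" if "A \<in> sets S" for A
    using measurable_sets[OF f that] sp mono_G[OF assms(1,2)] by auto
qed

text \<open>Freezing the past: \<open>F\<close> depends on \<omega> only through \<open>G k\<close>,
  so the new innovation is integrated out as an independent normal variable.\<close>

lemma nn_integral_innovation:
  fixes F :: "'a \<Rightarrow> real \<Rightarrow> ennreal"
  assumes k: "k < m" and F: "case_prod F \<in> borel_measurable (G k \<Otimes>\<^sub>M borel)"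
  shows "(\<integral>\<^sup>+\<omega>. F \<omega> (\<xi> k \<omega>) \<partial>N) =
    (\<integral>\<^sup>+\<omega>. (\<integral>\<^sup>+x. normal_density 0 (sqrt (v k)) x * F \<omega> x \<partial>lborel) \<partial>N)"
proof -
  let ?D = "density lborel (normal_density 0 (sqrt (v k)))"
  have id_G: "(\<lambda>\<omega>. \<omega>) \<in> measurable N (G k)"
    by (rule measurable_G_N[of k]) (use k in auto)
  have \<xi>: "\<xi> k \<in> borel_measurable N"
    by (rule measurable_G_N[OF _ \<xi>_G]) (use k in auto)
  have sD: "sigma_finite_measure ?D"
    using v_pos[OF k] prob_space_normal_density[of "sqrt (v k)" 0]
    by (simp add: prob_space_imp_sigma_finite)
  interpret D: sigma_finite_measure ?D by fact
  have F': "case_prod F \<in> borel_measurable (distr N (G k) (\<lambda>\<omega>. \<omega>) \<Otimes>\<^sub>M ?D)"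
    using F by (simp cong: measurable_cong_sets)
  have "(\<integral>\<^sup>+\<omega>. F \<omega> (\<xi> k \<omega>) \<partial>N) = (\<integral>\<^sup>+z. case_prod F z \<partial>distr N (G k \<Otimes>\<^sub>M borel) (\<lambda>\<omega>. (\<omega>, \<xi> k \<omega>)))"
    using id_G \<xi> F by (subst nn_integral_distr) auto
  also have "\<dots> = (\<integral>\<^sup>+\<omega>. \<integral>\<^sup>+x. F \<omega> x \<partial>?D \<partial>distr N (G k) (\<lambda>\<omega>. \<omega>))"
    unfolding innovation[OF k]
    using D.nn_integral_fst[OF F'] by simp
  also have "\<dots> = (\<integral>\<^sup>+\<omega>. \<integral>\<^sup>+x. F \<omega> x \<partial>?D \<partial>N)"
    by (subst nn_integral_distr[OF id_G])
       (use D.borel_measurable_nn_integral_fst[OF F'] in \<open>auto cong: measurable_cong_sets\<close>)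
  also have "\<dots> = (\<integral>\<^sup>+\<omega>. (\<integral>\<^sup>+x. normal_density 0 (sqrt (v k)) x * F \<omega> x \<partial>lborel) \<partial>N)"
  proof (rule nn_integral_cong)
    fix \<omega> assume "\<omega> \<in> space N"
    then have "\<omega> \<in> space (G k)" using space_G k by simp
    then have "F \<omega> \<in> borel_measurable borel"
      using measurable_Pair2[OF F] by simp
    then show "(\<integral>\<^sup>+x. F \<omega> x \<partial>?D) = (\<integral>\<^sup>+x. normal_density 0 (sqrt (v k)) x * F \<omega> x \<partial>lborel)"
      by (subst nn_integral_density) auto
  qed
  finally show ?thesis .
qed

section \<open>Predictable shifts, their energy and their likelihood\<close>

definition shifted :: "(nat \<Rightarrow> 'a \<Rightarrow> real) \<Rightarrow> nat \<Rightarrow> 'a \<Rightarrow> nat \<Rightarrow> real" where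
  "shifted a k \<omega> = (\<lambda>i. if i < k then \<xi> i \<omega> + a i \<omega> else 0)"

definition energy :: "(nat \<Rightarrow> 'a \<Rightarrow> real) \<Rightarrow> nat \<Rightarrow> 'a \<Rightarrow> real" where
  "energy a k \<omega> = (\<Sum>i<k. (a i \<omega>)\<^sup>2 / v i)"

text \<open>For predictable \<open>a\<close>, the discrete exponential martingale of the drift
  \<open>- a\<close>: the sum of \<open>a i * \<xi> i / v i\<close> is a discrete stochastic
  integral, compensated by half the \<open>energy\<close>.\<close>

definition likelihood :: "(nat \<Rightarrow> 'a \<Rightarrow> real) \<Rightarrow> nat \<Rightarrow> 'a \<Rightarrow> real" where
  "likelihood a k \<omega> = exp (- (\<Sum>i<k. a i \<omega> * \<xi> i \<omega> / v i + (a i \<omega>)\<^sup>2 / (2 * v i)))"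

lemma likelihood_pos: "0 < likelihood a k \<omega>"
  by (simp add: likelihood_def)

text \<open>Changing the sign of the drift flips the linear part of the exponent and keeps the
  quadratic one. So where the energy is bounded and one likelihood is small, the opposite one is
  large.\<close>

lemma inverse_likelihood:
  "likelihood (\<lambda>i \<omega>. - a i \<omega>) k \<omega> * likelihood a k \<omega> = exp (- energy a k \<omega>)"
  unfolding likelihood_def energy_def exp_add[symmetric] sum_negf[symmetric] sum.distrib[symmetric]
  by (intro arg_cong[where f = exp] sum.cong) (auto simp: field_simps)

text \<open>Doubling the drift quadruples the quadratic part of the exponent, squaring only doubles
  it; the difference is the energy. A bounded energy thus reduces the second moment to the total
  mass of another likelihood.\<close>

lemma square_likelihood:
  "(likelihood a k \<omega>)\<^sup>2 = likelihood (\<lambda>i \<omega>. 2 * a i \<omega>) k \<omega> * exp (energy a k \<omega>)"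
  unfolding likelihood_def energy_def exp_add[symmetric] sum_negf[symmetric] sum.distrib[symmetric]
    power2_eq_square
  by (intro arg_cong[where f = exp] sum.cong) (auto simp: field_simps)

context
  fixes a :: "nat \<Rightarrow> 'a \<Rightarrow> real"
  assumes a_G: "\<And>i. i < m \<Longrightarrow> a i \<in> borel_measurable (G i)"
begin

lemma summand_measurable:
  assumes "i < k" "k \<le> m"
  shows "\<xi> i \<in> borel_measurable (G k)" "a i \<in> borel_measurable (G k)"
  using measurable_G_mono[OF _ _ \<xi>_G, of i k] measurable_G_mono[OF _ _ a_G, of i k] assms by auto

lemma shifted_measurable: "k \<le> m \<Longrightarrow> shifted a k \<in> borel_measurable (G k)"
  unfolding shifted_def[abs_def]
  by (rule measurable_coordinatewise_then_product, rename_tac i, case_tac "i < k")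
     (auto intro!: borel_measurable_add summand_measurable)

lemma likelihood_measurable: "k \<le> m \<Longrightarrow> likelihood a k \<in> borel_measurable (G k)"
  unfolding likelihood_def[abs_def]
  by (intro borel_measurable_uminus borel_measurable_exp borel_measurable_sum measurable_compose[OF _ borel_measurable_exp] borel_measurable_add borel_measurable_divide borel_measurable_times borel_measurable_power borel_measurable_const)
     (auto simp: summand_measurable)

lemma energy_measurable: "k \<le> m \<Longrightarrow> energy a k \<in> borel_measurable (G k)"
  unfolding energy_def[abs_def]
  by (intro borel_measurable_sum borel_measurable_divide borel_measurable_power borel_measurable_const)
     (auto simp: summand_measurable)

end

text \<open>With the past frozen, \<open>a k\<close> is a constant, as it is measurable for
  \<open>G k\<close>. The last factor of the likelihood moves the normal density to
  \<open>a k + x\<close>, and translation invariance of Lebesgue measure removes the shift.\<close>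

lemma girsanov_step:
  fixes f :: "(nat \<Rightarrow> real) \<Rightarrow> ennreal"
  assumes a_G: "\<And>i. i < m \<Longrightarrow> a i \<in> borel_measurable (G i)"
    and k: "k < m" and f: "f \<in> borel_measurable borel"
  shows "(\<integral>\<^sup>+\<omega>. ennreal (likelihood a (Suc k) \<omega>) * f (shifted a (Suc k) \<omega>) \<partial>N) =
    (\<integral>\<^sup>+\<omega>. ennreal (likelihood a k \<omega>) *
       (\<integral>\<^sup>+x. normal_density 0 (sqrt (v k)) x * f ((shifted a k \<omega>)(k := x)) \<partial>lborel) \<partial>N)"
proof -
  let ?\<phi> = "normal_density 0 (sqrt (v k))"
  define F where "F \<omega> x = ennreal (likelihood a k \<omega> * exp (- (a k \<omega> * x / v k + (a k \<omega>)\<^sup>2 / (2 * v k))))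
    * f ((shifted a k \<omega>)(k := a k \<omega> + x))" for \<omega> x
  note [measurable] = a_G[OF k] f
  have [measurable]: "likelihood a k \<in> borel_measurable (G k)" "shifted a k \<in> borel_measurable (G k)"
    using likelihood_measurable[OF a_G] shifted_measurable[OF a_G] k by auto
  have upd: "(\<lambda>z. (shifted a k (fst z))(k := a k (fst z) + snd z)) \<in> borel_measurable (G k \<Otimes>\<^sub>M borel)"
  proof (rule measurable_coordinatewise_then_product)
    fix i
    have "(\<lambda>\<omega>. shifted a k \<omega> i) \<in> borel_measurable (G k)"
      by (rule measurable_product_then_coordinatewise[OF \<open>shifted a k \<in> borel_measurable (G k)\<close>])
    then show "(\<lambda>x. ((shifted a k (fst x))(k := a k (fst x) + snd x)) i) \<in> borel_measurable (G k \<Otimes>\<^sub>M borel)"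
      by (cases "i = k") auto
  qed
  have F_meas: "case_prod F \<in> borel_measurable (G k \<Otimes>\<^sub>M borel)"
    unfolding F_def case_prod_beta using measurable_compose[OF upd f] by measurable
  have "(\<integral>\<^sup>+\<omega>. ennreal (likelihood a (Suc k) \<omega>) * f (shifted a (Suc k) \<omega>) \<partial>N) = (\<integral>\<^sup>+\<omega>. F \<omega> (\<xi> k \<omega>) \<partial>N)"
  proof (rule nn_integral_cong)
    fix \<omega>
    have "shifted a (Suc k) \<omega> = (shifted a k \<omega>)(k := a k \<omega> + \<xi> k \<omega>)"
      by (auto simp: shifted_def fun_eq_iff less_Suc_eq)
    moreover have "likelihood a (Suc k) \<omega> = likelihood a k \<omega> * exp (- (a k \<omega> * \<xi> k \<omega> / v k + (a k \<omega>)\<^sup>2 / (2 * v k)))"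
      unfolding likelihood_def by (simp add: exp_add[symmetric])
    ultimately show "ennreal (likelihood a (Suc k) \<omega>) * f (shifted a (Suc k) \<omega>) = F \<omega> (\<xi> k \<omega>)"
      by (simp add: F_def)
  qed
  also have "\<dots> = (\<integral>\<^sup>+\<omega>. (\<integral>\<^sup>+x. ?\<phi> x * F \<omega> x \<partial>lborel) \<partial>N)"
    by (rule nn_integral_innovation[OF k F_meas])
  also have "\<dots> = (\<integral>\<^sup>+\<omega>. ennreal (likelihood a k \<omega>) * (\<integral>\<^sup>+x. ?\<phi> x * f ((shifted a k \<omega>)(k := x)) \<partial>lborel) \<partial>N)"
  proof (rule nn_integral_cong)
    fix \<omega>
    have upd': "(\<lambda>x. (shifted a k \<omega>)(k := x)) \<in> borel_measurable borel"
      by (rule measurable_coordinatewise_then_product) auto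
    have g[measurable]: "(\<lambda>x. f ((shifted a k \<omega>)(k := x))) \<in> borel_measurable borel"
      by (rule measurable_compose[OF upd' f])
    have "(\<integral>\<^sup>+x. ?\<phi> x * F \<omega> x \<partial>lborel) =
      (\<integral>\<^sup>+x. ennreal (likelihood a k \<omega>) * (ennreal (?\<phi> (a k \<omega> + x)) * f ((shifted a k \<omega>)(k := a k \<omega> + x))) \<partial>lborel)"
      unfolding F_def normal_density_exp_shift[OF v_pos[OF k], symmetric]
      by (intro nn_integral_cong) (simp add: ennreal_mult' likelihood_pos less_imp_le mult_ac)
    also have "\<dots> = ennreal (likelihood a k \<omega>) *
        (\<integral>\<^sup>+x. ennreal (?\<phi> (a k \<omega> + x)) * f ((shifted a k \<omega>)(k := a k \<omega> + x)) \<partial>lborel)"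
      by (rule nn_integral_cmult) measurable
    also have "(\<integral>\<^sup>+x. ennreal (?\<phi> (a k \<omega> + x)) * f ((shifted a k \<omega>)(k := a k \<omega> + x)) \<partial>lborel)
      = (\<integral>\<^sup>+x. ?\<phi> x * f ((shifted a k \<omega>)(k := x)) \<partial>lborel)"
      using nn_integral_real_affine[of "\<lambda>x. ennreal (?\<phi> x) * f ((shifted a k \<omega>)(k := x))" 1 "a k \<omega>"]
      by simp
    finally show "(\<integral>\<^sup>+x. ?\<phi> x * F \<omega> x \<partial>lborel) =
      ennreal (likelihood a k \<omega>) * (\<integral>\<^sup>+x. ?\<phi> x * f ((shifted a k \<omega>)(k := x)) \<partial>lborel)" .
  qed
  finally show ?thesis .
qed

text \<open>Induction over the steps for all \<open>f\<close> at once: integrating out the last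
  coordinate replaces \<open>f\<close> by a function \<open>g\<close> of the earlier ones. For
  \<open>f = 1\<close> the formula says that the likelihood has total mass 1.\<close>

theorem discrete_girsanov:
  fixes f :: "(nat \<Rightarrow> real) \<Rightarrow> ennreal"
  assumes a_G: "\<And>i. i < m \<Longrightarrow> a i \<in> borel_measurable (G i)"
    and "k \<le> m" and "f \<in> borel_measurable borel"
  shows "(\<integral>\<^sup>+\<omega>. ennreal (likelihood a k \<omega>) * f (shifted a k \<omega>) \<partial>N) =
    (\<integral>\<^sup>+\<omega>. f (shifted (\<lambda>_ _. 0) k \<omega>) \<partial>N)"
  using assms(2,3)
proof (induction k arbitrary: f)
  case 0
  then show ?case by (simp add: likelihood_def shifted_def)
next
  case (Suc k)
  define g where "g y = (\<integral>\<^sup>+x. normal_density 0 (sqrt (v k)) x * f (y(k := x)) \<partial>lborel)" for y :: "nat \<Rightarrow> real"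
  have "(\<lambda>z. (fst z)(k := snd z)) \<in> borel_measurable ((borel :: (nat \<Rightarrow> real) measure) \<Otimes>\<^sub>M lborel)"
  proof (rule measurable_coordinatewise_then_product)
    fix i
    have "(\<lambda>z. fst z i) \<in> borel_measurable ((borel :: (nat \<Rightarrow> real) measure) \<Otimes>\<^sub>M lborel)"
      by (rule measurable_product_then_coordinatewise) (rule measurable_fst)
    then show "(\<lambda>z. ((fst z)(k := snd z)) i) \<in> borel_measurable ((borel :: (nat \<Rightarrow> real) measure) \<Otimes>\<^sub>M lborel)"
      by (cases "i = k") auto
  qed
  from measurable_compose[OF this Suc.prems(2)]
  have "(\<lambda>z. normal_density 0 (sqrt (v k)) (snd z) * f ((fst z)(k := snd z))) \<in> borel_measurable (borel \<Otimes>\<^sub>M lborel)"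
    by measurable
  then have g: "g \<in> borel_measurable borel"
    unfolding g_def by (intro lborel.borel_measurable_nn_integral) (simp add: case_prod_beta)
  have "(\<integral>\<^sup>+\<omega>. ennreal (likelihood a (Suc k) \<omega>) * f (shifted a (Suc k) \<omega>) \<partial>N) =
      (\<integral>\<^sup>+\<omega>. ennreal (likelihood a k \<omega>) * g (shifted a k \<omega>) \<partial>N)"
    unfolding g_def using Suc.prems by (intro girsanov_step a_G) auto
  also have "\<dots> = (\<integral>\<^sup>+\<omega>. g (shifted (\<lambda>_ _. 0) k \<omega>) \<partial>N)"
    using Suc.prems g by (intro Suc.IH) auto
  \<comment> \<open>The same step with zero drift, whose likelihood is 1, read from right to left:
    it puts the last innovation back.\<close>
  also have "\<dots> = (\<integral>\<^sup>+\<omega>. f (shifted (\<lambda>_ _. 0) (Suc k) \<omega>) \<partial>N)"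
    unfolding g_def using girsanov_step[of "\<lambda>_ _. 0" k f] Suc.prems by (simp add: likelihood_def)
  finally show ?case .
qed

section \<open>Two-sided comparison with constants independent of the number of steps\<close>

lemma nn_integral_shifted:
  fixes f :: "(nat \<Rightarrow> real) \<Rightarrow> real"
  assumes a_G: "\<And>i. i < m \<Longrightarrow> a i \<in> borel_measurable (G i)"
    and f: "f \<in> borel_measurable borel" "\<And>x. 0 \<le> f x" "\<And>x. f x \<le> 1"
  shows "(\<integral>\<^sup>+\<omega>. ennreal (f (shifted a m \<omega>)) \<partial>N) = ennreal (expectation (\<lambda>\<omega>. f (shifted a m \<omega>)))"
proof (rule nn_integral_eq_integral)
  have "(\<lambda>\<omega>. f (shifted a m \<omega>)) \<in> borel_measurable N"
    by (rule measurable_G_N[of m]) (auto intro: measurable_compose[OF shifted_measurable[OF a_G] f(1)])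
  then show "integrable N (\<lambda>\<omega>. f (shifted a m \<omega>))"
    by (rule integrable_const_bound[where B = 1, rotated]) (use f in auto)
qed (use f in auto)

text \<open>The first term covers the event that the energy exceeds \<open>R\<close> (Markov), the second one the event
  that the energy is below \<open>R\<close> and the likelihood is below \<open>\<delta>\<close>: there the likelihood of the opposite
  shift, which has expectation 1, exceeds \<open>exp (- R) / \<delta>\<close>.\<close>

lemma shifted_le:
  fixes f :: "(nat \<Rightarrow> real) \<Rightarrow> real"
  assumes a_G: "\<And>i. i < m \<Longrightarrow> a i \<in> borel_measurable (G i)"
    and f: "f \<in> borel_measurable borel" "\<And>x. 0 \<le> f x" "\<And>x. f x \<le> 1"
    and C: "(\<integral>\<^sup>+\<omega>. ennreal (energy a m \<omega>) \<partial>N) \<le> ennreal C" "0 \<le> C"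
    and R: "0 < R" and \<delta>: "0 < \<delta>"
  shows "expectation (\<lambda>\<omega>. f (shifted a m \<omega>)) \<le>
    C / R + \<delta> * exp R + expectation (\<lambda>\<omega>. f (shifted (\<lambda>_ _. 0) m \<omega>)) / \<delta>"
proof -
  let ?X = "shifted a m" and ?Y = "shifted (\<lambda>_ _. 0) m"
  let ?Z = "likelihood a m" and ?Z' = "likelihood (\<lambda>i \<omega>. - a i \<omega>) m"
  have a'_G: "(\<lambda>\<omega>. - a i \<omega>) \<in> borel_measurable (G i)" if "i < m" for i
    using a_G[OF that] by measurable
  have [measurable]: "?Z \<in> borel_measurable N" "?Z' \<in> borel_measurable N"
      "energy a m \<in> borel_measurable N" "?X \<in> borel_measurable N"
    using measurable_G_N[OF _ likelihood_measurable[OF a_G], of m]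
      measurable_G_N[OF _ likelihood_measurable[OF a'_G], of m]
      measurable_G_N[OF _ energy_measurable[OF a_G], of m]
      measurable_G_N[OF _ shifted_measurable[OF a_G], of m] by auto
  note [measurable] = f(1)
  have energy_nonneg: "0 \<le> energy a m \<omega>" for \<omega>
    using v_pos by (auto simp: energy_def intro!: sum_nonneg divide_nonneg_pos)
  \<comment> \<open>The third term covers the remaining event, where the likelihood is at least
    \<delta> and so \<open>f\<close> is at most \<open>1 / \<delta>\<close> times likelihood times
    \<open>f\<close>. The Girsanov formula turns its expectation into that of the unshifted
    variables.\<close>
  have pointwise: "f (?X \<omega>) \<le> energy a m \<omega> / R + \<delta> * exp R * ?Z' \<omega> + 1 / \<delta> * (?Z \<omega> * f (?X \<omega>))" for \<omega>
  proof -
    let ?q = "energy a m \<omega>"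
    have pos: "0 \<le> ?q / R" "0 \<le> \<delta> * exp R * ?Z' \<omega>" "0 \<le> 1 / \<delta> * (?Z \<omega> * f (?X \<omega>))"
      using R \<delta> f(2) energy_nonneg by (auto simp: less_imp_le[OF likelihood_pos])
    consider "R \<le> ?q" | "\<delta> \<le> ?Z \<omega>" | "?q < R" "?Z \<omega> < \<delta>" by linarith
    then show ?thesis
    proof cases
      case 1
      then have "1 \<le> ?q / R" using R by simp
      then show ?thesis using pos f(3)[of "?X \<omega>"] by linarith
    next
      case 2
      then have "1 * f (?X \<omega>) \<le> ?Z \<omega> / \<delta> * f (?X \<omega>)"
        using \<delta> f(2) by (intro mult_right_mono) auto
      then show ?thesis using pos by simp
    next
      case 3
      have "exp (- R) \<le> exp (- ?q)" using 3 by simp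
      also have "\<dots> \<le> ?Z' \<omega> * \<delta>"
        unfolding inverse_likelihood[symmetric] using 3
        by (intro mult_left_mono) (auto simp: less_imp_le[OF likelihood_pos])
      finally have "exp R * exp (- R) \<le> exp R * (?Z' \<omega> * \<delta>)"
        by (intro mult_left_mono) auto
      then have "1 \<le> \<delta> * exp R * ?Z' \<omega>"
        by (simp add: exp_minus mult_ac)
      then show ?thesis using pos f(3)[of "?X \<omega>"] by linarith
    qed
  qed
  have X0_nonneg: "0 \<le> expectation (\<lambda>\<omega>. f (?Y \<omega>))"
    using f(2) by (rule Bochner_Integration.integral_nonneg)
  have "ennreal (expectation (\<lambda>\<omega>. f (?X \<omega>))) = (\<integral>\<^sup>+\<omega>. ennreal (f (?X \<omega>)) \<partial>N)"
    by (rule nn_integral_shifted[OF a_G f, symmetric])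
  \<comment> \<open>The factor \<open>* 1\<close> keeps the opposite likelihood in the form of
    \<open>discrete_girsanov\<close> for a constant function.\<close>
  also have "\<dots> \<le> (\<integral>\<^sup>+\<omega>. ennreal (1 / R) * ennreal (energy a m \<omega>)
      + ennreal (\<delta> * exp R) * (ennreal (?Z' \<omega>) * 1)
      + ennreal (1 / \<delta>) * (ennreal (?Z \<omega>) * ennreal (f (?X \<omega>))) \<partial>N)"
  proof (rule nn_integral_mono)
    fix \<omega>
    have "ennreal (1 / R) * ennreal (energy a m \<omega>)
      + ennreal (\<delta> * exp R) * (ennreal (?Z' \<omega>) * 1)
      + ennreal (1 / \<delta>) * (ennreal (?Z \<omega>) * ennreal (f (?X \<omega>))) =
      ennreal (energy a m \<omega> / R + \<delta> * exp R * ?Z' \<omega> + 1 / \<delta> * (?Z \<omega> * f (?X \<omega>)))"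
      using R \<delta> f(2) energy_nonneg
      by (simp add: ennreal_mult'[symmetric] ennreal_plus[symmetric] less_imp_le[OF likelihood_pos] del: ennreal_plus)
    then show "ennreal (f (?X \<omega>)) \<le> ennreal (1 / R) * ennreal (energy a m \<omega>)
      + ennreal (\<delta> * exp R) * (ennreal (?Z' \<omega>) * 1)
      + ennreal (1 / \<delta>) * (ennreal (?Z \<omega>) * ennreal (f (?X \<omega>)))"
      using pointwise[of \<omega>] by (simp add: ennreal_leI del: ennreal_plus)
  qed
  also have "\<dots> = ennreal (1 / R) * (\<integral>\<^sup>+\<omega>. ennreal (energy a m \<omega>) \<partial>N)
      + ennreal (\<delta> * exp R) * (\<integral>\<^sup>+\<omega>. ennreal (?Z' \<omega>) * 1 \<partial>N)
      + ennreal (1 / \<delta>) * (\<integral>\<^sup>+\<omega>. ennreal (?Z \<omega>) * ennreal (f (?X \<omega>)) \<partial>N)"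
    by (simp add: nn_integral_add nn_integral_cmult)
  also have "(\<integral>\<^sup>+\<omega>. ennreal (?Z' \<omega>) * 1 \<partial>N) = 1"
    using discrete_girsanov[OF a'_G, of m "\<lambda>_. 1"] by (simp add: emeasure_space_1)
  also have "(\<integral>\<^sup>+\<omega>. ennreal (?Z \<omega>) * ennreal (f (?X \<omega>)) \<partial>N) = (\<integral>\<^sup>+\<omega>. ennreal (f (?Y \<omega>)) \<partial>N)"
    using discrete_girsanov[OF a_G, of m "\<lambda>x. ennreal (f x)"] by simp
  also have "\<dots> = ennreal (expectation (\<lambda>\<omega>. f (?Y \<omega>)))"
    by (rule nn_integral_shifted[OF _ f]) simp
  also have "ennreal (1 / R) * (\<integral>\<^sup>+\<omega>. ennreal (energy a m \<omega>) \<partial>N) \<le> ennreal (1 / R) * ennreal C"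
    by (intro mult_left_mono C) simp
  finally have "ennreal (expectation (\<lambda>\<omega>. f (?X \<omega>))) \<le> ennreal (1 / R) * ennreal C
      + ennreal (\<delta> * exp R) * 1 + ennreal (1 / \<delta>) * ennreal (expectation (\<lambda>\<omega>. f (?Y \<omega>)))"
    by (simp add: add_mono)
  also have "\<dots> = ennreal (C / R + \<delta> * exp R + expectation (\<lambda>\<omega>. f (?Y \<omega>)) / \<delta>)"
    using R \<delta> C X0_nonneg by (simp add: ennreal_mult'[symmetric] ennreal_plus[symmetric] del: ennreal_plus)
  finally have le: "ennreal (expectation (\<lambda>\<omega>. f (?X \<omega>))) \<le>
      ennreal (C / R + \<delta> * exp R + expectation (\<lambda>\<omega>. f (?Y \<omega>)) / \<delta>)" .
  have "0 \<le> C / R + \<delta> * exp R + expectation (\<lambda>\<omega>. f (?Y \<omega>)) / \<delta>"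
    using R \<delta> C(2) X0_nonneg by (simp add: add_nonneg_nonneg)
  then show ?thesis using ennreal_le_iff le by blast
qed

text \<open>A bounded energy bounds the second moment of the likelihood \<open>Z\<close>, and \<open>Z \<le> K + Z\<^sup>2 / K\<close>.\<close>

lemma unshifted_le:
  fixes f :: "(nat \<Rightarrow> real) \<Rightarrow> real"
  assumes a_G: "\<And>i. i < m \<Longrightarrow> a i \<in> borel_measurable (G i)"
    and f: "f \<in> borel_measurable borel" "\<And>x. 0 \<le> f x" "\<And>x. f x \<le> 1"
    and C: "AE \<omega> in N. energy a m \<omega> \<le> C"
    and K: "0 < K"
  shows "expectation (\<lambda>\<omega>. f (shifted (\<lambda>_ _. 0) m \<omega>)) \<le>
    exp C / K + K * expectation (\<lambda>\<omega>. f (shifted a m \<omega>))"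
proof -
  let ?X = "shifted a m" and ?Y = "shifted (\<lambda>_ _. 0) m"
  let ?Z = "likelihood a m" and ?V = "likelihood (\<lambda>i \<omega>. 2 * a i \<omega>) m"
  have a2_G: "(\<lambda>\<omega>. 2 * a i \<omega>) \<in> borel_measurable (G i)" if "i < m" for i
    using a_G[OF that] by measurable
  have [measurable]: "?V \<in> borel_measurable N" "?X \<in> borel_measurable N"
    using measurable_G_N[OF _ likelihood_measurable[OF a2_G], of m]
      measurable_G_N[OF _ shifted_measurable[OF a_G], of m] by auto
  note [measurable] = f(1)
  have pointwise: "?Z \<omega> * f (?X \<omega>) \<le> exp C / K * ?V \<omega> + K * f (?X \<omega>)"
    if "energy a m \<omega> \<le> C" for \<omega>
  proof (cases "?Z \<omega> \<le> K")
    case True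
    then have "?Z \<omega> * f (?X \<omega>) \<le> K * f (?X \<omega>)" using f(2) by (intro mult_right_mono) auto
    then show ?thesis using K by (simp add: add_increasing less_imp_le[OF likelihood_pos])
  next
    case False
    have "?Z \<omega> * f (?X \<omega>) \<le> ?Z \<omega>"
      using f(3)[of "?X \<omega>"] likelihood_pos[of a m \<omega>] by (simp add: mult_left_le)
    also have "\<dots> \<le> (?Z \<omega>)\<^sup>2 / K"
      using False K likelihood_pos[of a m \<omega>] by (simp add: power2_eq_square pos_le_divide_eq)
    \<comment> \<open>By \<open>square_likelihood\<close> and the energy bound, the squared
      likelihood is at most \<open>exp C\<close> times the likelihood \<open>?V\<close> of the
      doubled drift, whose expectation is 1.\<close>
    also have "\<dots> \<le> exp C / K * ?V \<omega>"
      unfolding square_likelihood using that K likelihood_pos[of "\<lambda>i \<omega>. 2 * a i \<omega>" m \<omega>]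
      by (simp add: divide_right_mono mult.commute)
    finally show ?thesis using K f(2)[of "?X \<omega>"] by (simp add: add_increasing2)
  qed
  have X_nonneg: "0 \<le> expectation (\<lambda>\<omega>. f (?X \<omega>))"
    using f(2) by (rule Bochner_Integration.integral_nonneg)
  have "ennreal (expectation (\<lambda>\<omega>. f (?Y \<omega>))) = (\<integral>\<^sup>+\<omega>. ennreal (f (?Y \<omega>)) \<partial>N)"
    by (rule nn_integral_shifted[OF _ f, symmetric]) simp
  also have "\<dots> = (\<integral>\<^sup>+\<omega>. ennreal (?Z \<omega>) * ennreal (f (?X \<omega>)) \<partial>N)"
    using discrete_girsanov[OF a_G, of m "\<lambda>x. ennreal (f x)"] by simp
  also have "\<dots> \<le> (\<integral>\<^sup>+\<omega>. ennreal (exp C / K) * (ennreal (?V \<omega>) * 1) + ennreal K * ennreal (f (?X \<omega>)) \<partial>N)"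
    using C
  proof (intro nn_integral_mono_AE, eventually_elim)
    case (elim \<omega>)
    then show ?case
      using pointwise[of \<omega>] K f(2)
      by (simp add: ennreal_mult'[symmetric] ennreal_plus[symmetric] ennreal_leI less_imp_le[OF likelihood_pos]
          del: ennreal_plus)
  qed
  also have "\<dots> = ennreal (exp C / K) * (\<integral>\<^sup>+\<omega>. ennreal (?V \<omega>) * 1 \<partial>N) + ennreal K * (\<integral>\<^sup>+\<omega>. ennreal (f (?X \<omega>)) \<partial>N)"
    by (simp add: nn_integral_add nn_integral_cmult)
  also have "(\<integral>\<^sup>+\<omega>. ennreal (?V \<omega>) * 1 \<partial>N) = 1"
    using discrete_girsanov[OF a2_G, of m "\<lambda>_. 1"] by (simp add: emeasure_space_1)
  also have "(\<integral>\<^sup>+\<omega>. ennreal (f (?X \<omega>)) \<partial>N) = ennreal (expectation (\<lambda>\<omega>. f (?X \<omega>)))"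
    by (rule nn_integral_shifted[OF a_G f])
  also have "ennreal (exp C / K) * 1 + ennreal K * ennreal (expectation (\<lambda>\<omega>. f (?X \<omega>))) =
      ennreal (exp C / K + K * expectation (\<lambda>\<omega>. f (?X \<omega>)))"
    using K X_nonneg by (simp add: ennreal_mult'[symmetric] ennreal_plus[symmetric] del: ennreal_plus)
  finally have le: "ennreal (expectation (\<lambda>\<omega>. f (?Y \<omega>))) \<le>
      ennreal (exp C / K + K * expectation (\<lambda>\<omega>. f (?X \<omega>)))" .
  have "0 \<le> exp C / K + K * expectation (\<lambda>\<omega>. f (?X \<omega>))"
    using K X_nonneg by (simp add: add_nonneg_nonneg)
  then show ?thesis using ennreal_le_iff le by blast
qed

end

section \<open>Borel sets of the path space\<close>

text \<open>The sequence \<open>d\<close> belongs to the locale because paths are observed through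
  their countably many values at its points. It may repeat, so a finite \<open>T\<close> is
  covered.\<close>

locale time_scale =
  fixes T :: "real set" and d :: "nat \<Rightarrow> real"
  assumes closed_T: "closed T" and zero_T: "0 \<in> T" and one_T: "1 \<in> T" and T_subset: "T \<subseteq> {0..1}"
    and d_T: "d i \<in> T" and dense_d: "T \<subseteq> closure (range d)"
begin

lemma T_bounds: "t \<in> T \<Longrightarrow> 0 \<le> t" "t \<in> T \<Longrightarrow> t \<le> 1"
  using T_subset by auto

lemma compact_T: "compact T"
  using closed_T T_subset by (meson bounded_closed_interval bounded_subset compact_eq_bounded_closed)

lemma closure_range_d: "closure (range d) = T"
  using dense_d d_T closed_T closure_minimal[of "range d" T] by auto

lemma mem_CT: "\<omega> \<in> CT T \<longleftrightarrow> continuous_on T \<omega> \<and> \<omega> \<in> extensional T \<and> \<omega> 0 = 0"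
  unfolding CT_def CT_metric_def
  using compact_T by (subst mspace_submetric, subst compactin_mspace_cfunspace) auto

lemma CT_continuous: "\<omega> \<in> CT T \<Longrightarrow> continuous_on T \<omega>"
  and CT_zero: "\<omega> \<in> CT T \<Longrightarrow> \<omega> 0 = 0"
  by (auto simp: mem_CT)

lemma restrict_mem_CT: "continuous_on T f \<Longrightarrow> f 0 = 0 \<Longrightarrow> restrict f T \<in> CT T"
  using zero_T by (auto simp: mem_CT)

lemma mdist_CT_le:
  assumes "f \<in> CT T" "g \<in> CT T"
  shows "mdist (CT_metric T) f g \<le> a \<longleftrightarrow> (\<forall>t\<in>T. \<bar>f t - g t\<bar> \<le> a)"
  using assms zero_T unfolding CT_def CT_metric_def mdist_submetric
  by (subst cfunspace_mdist_le) (auto simp: dist_real_def simp del: mspace_cfunspace)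

lemma abs_diff_le_mdist_CT: "f \<in> CT T \<Longrightarrow> g \<in> CT T \<Longrightarrow> t \<in> T \<Longrightarrow> \<bar>f t - g t\<bar> \<le> mdist (CT_metric T) f g"
  using mdist_CT_le by blast

text \<open>This reduces uniform closeness of paths to countably many conditions on
  coordinates.\<close>

lemma mdist_CT_le_dense:
  assumes f: "f \<in> CT T" and g: "g \<in> CT T" and le: "\<And>i. \<bar>f (d i) - g (d i)\<bar> \<le> a"
  shows "mdist (CT_metric T) f g \<le> a"
  unfolding mdist_CT_le[OF f g]
proof
  fix t assume "t \<in> T"
  show "\<bar>f t - g t\<bar> \<le> a"
  proof (rule continuous_le_on_closure[where S = "range d" and x = t and f = "\<lambda>t. \<bar>f t - g t\<bar>"])
    show "continuous_on (closure (range d)) (\<lambda>t. \<bar>f t - g t\<bar>)"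
      unfolding closure_range_d using CT_continuous[OF f] CT_continuous[OF g] by (intro continuous_intros)
  qed (use le \<open>t \<in> T\<close> closure_range_d in auto)
qed

lemma openin_CT:
  "openin (mtopology_of (CT_metric T)) U \<longleftrightarrow>
    U \<subseteq> CT T \<and> (\<forall>\<omega>\<in>U. \<exists>r>0. \<forall>\<omega>'\<in>CT T. mdist (CT_metric T) \<omega> \<omega>' < r \<longrightarrow> \<omega>' \<in> U)"
proof -
  interpret Metric_space "mspace (CT_metric T)" "mdist (CT_metric T)"
    by (rule Metric_space_mspace_mdist)
  show ?thesis
    unfolding mtopology_of_def openin_mtopology CT_def
  proof (intro conj_cong refl iffI ballI allI impI)
    fix \<omega> assume sub: "U \<subseteq> mspace (CT_metric T)"
    show "\<exists>r>0. \<forall>\<omega>'\<in>mspace (CT_metric T). mdist (CT_metric T) \<omega> \<omega>' < r \<longrightarrow> \<omega>' \<in> U"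
      if open_U: "\<forall>\<omega>. \<omega> \<in> U \<longrightarrow> (\<exists>r>0. mball \<omega> r \<subseteq> U)" and "\<omega> \<in> U"
    proof -
      obtain r where r: "r > 0" "mball \<omega> r \<subseteq> U" using open_U \<open>\<omega> \<in> U\<close> by blast
      have "\<omega> \<in> mspace (CT_metric T)" using sub \<open>\<omega> \<in> U\<close> by auto
      then show ?thesis
        using r(1) by (intro exI[of _ r]) (auto intro!: subsetD[OF r(2)])
    qed
    show "\<exists>r>0. mball \<omega> r \<subseteq> U"
      if open_U: "\<forall>\<omega>\<in>U. \<exists>r>0. \<forall>\<omega>'\<in>mspace (CT_metric T). mdist (CT_metric T) \<omega> \<omega>' < r \<longrightarrow> \<omega>' \<in> U"
        and "\<omega> \<in> U"
    proof -
      obtain r where "r > 0"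
        "\<forall>\<omega>'\<in>mspace (CT_metric T). mdist (CT_metric T) \<omega> \<omega>' < r \<longrightarrow> \<omega>' \<in> U"
        using open_U \<open>\<omega> \<in> U\<close> by blast
      then show ?thesis by (intro exI[of _ r]) auto
    qed
  qed
qed

lemma space_borel_CT [simp]: "space (borel_CT T) = CT T"
  and sets_borel_CT: "sets (borel_CT T) = sigma_sets (CT T) {U. openin (mtopology_of (CT_metric T)) U}"
proof -
  have "{U. openin (mtopology_of (CT_metric T)) U} \<subseteq> Pow (CT T)" using openin_CT by auto
  then show "space (borel_CT T) = CT T"
    "sets (borel_CT T) = sigma_sets (CT T) {U. openin (mtopology_of (CT_metric T)) U}"
    unfolding borel_CT_def by (rule space_measure_of, rule sets_measure_of)
qed

lemma measurable_eval [measurable]: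
  assumes "t \<in> T"
  shows "(\<lambda>\<omega>. \<omega> t) \<in> borel_measurable (borel_CT T)"
proof (rule borel_measurableI)
  fix S :: "real set" assume S: "open S"
  have "openin (mtopology_of (CT_metric T)) ((\<lambda>\<omega>. \<omega> t) -` S \<inter> CT T)"
    unfolding openin_CT
  proof (intro conjI ballI)
    fix \<omega> assume \<omega>: "\<omega> \<in> (\<lambda>\<omega>. \<omega> t) -` S \<inter> CT T"
    then obtain r where r: "r > 0" "\<And>y. dist y (\<omega> t) < r \<Longrightarrow> y \<in> S"
      using S by (auto simp: open_dist)
    have "\<omega>' \<in> (\<lambda>\<omega>. \<omega> t) -` S \<inter> CT T" if "\<omega>' \<in> CT T" "mdist (CT_metric T) \<omega> \<omega>' < r" for \<omega>'
      using abs_diff_le_mdist_CT[of \<omega> \<omega>' t] that \<omega> assms r(2)[of "\<omega>' t"]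
      by (auto simp: dist_real_def abs_minus_commute)
    then show "\<exists>r>0. \<forall>\<omega>'\<in>CT T. mdist (CT_metric T) \<omega> \<omega>' < r \<longrightarrow> \<omega>' \<in> (\<lambda>\<omega>. \<omega> t) -` S \<inter> CT T"
      using r(1) by blast
  qed auto
  then show "(\<lambda>\<omega>. \<omega> t) -` S \<inter> space (borel_CT T) \<in> sets (borel_CT T)"
    unfolding sets_borel_CT space_borel_CT by (intro sigma_sets.Basic) simp
qed

text \<open>Open sets are countable unions of the measurable sets \<open>C (N, q, k)\<close> of paths that are
  \<open>1 / (k + 1)\<close>-close to the step function with rational values \<open>q\<close> on a grid of mesh \<open>1 / N\<close>.\<close>

lemma openin_CT_mem_sets:
  assumes U: "openin (mtopology_of (CT_metric T)) U"
    and M: "space M = CT T" "\<And>i. (\<lambda>\<omega>. \<omega> (d i)) \<in> borel_measurable M"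
  shows "U \<in> sets M"
proof -
  define C where "C = (\<lambda>(N :: nat, q :: rat list, k :: nat).
    {\<omega>\<in>CT T. \<forall>i. \<bar>\<omega> (d i) - real_of_rat (q ! nat \<lfloor>real N * d i\<rfloor>)\<bar> \<le> 1 / real (Suc k)})"
  note [measurable] = M(2)
  have C_sets: "C z \<in> sets M" for z
  proof -
    obtain N q k where z: "z = (N, q, k)" by (cases z)
    have "{\<omega>\<in>space M. \<forall>i. \<bar>\<omega> (d i) - real_of_rat (q ! nat \<lfloor>real N * d i\<rfloor>)\<bar> \<le> 1 / real (Suc k)} \<in> sets M"
      by measurable
    then show ?thesis by (simp add: z C_def M)
  qed
  have "U = (\<Union>z\<in>{z. C z \<subseteq> U}. C z)"
  proof
    show "U \<subseteq> (\<Union>z\<in>{z. C z \<subseteq> U}. C z)"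
    proof
      fix \<omega> assume "\<omega> \<in> U"
      then have \<omega>: "\<omega> \<in> CT T" using U openin_CT by auto
      obtain r where r: "r > 0" "\<And>\<omega>'. \<omega>' \<in> CT T \<Longrightarrow> mdist (CT_metric T) \<omega> \<omega>' < r \<Longrightarrow> \<omega>' \<in> U"
        using U \<open>\<omega> \<in> U\<close> unfolding openin_CT by blast
      obtain k where k: "inverse (real (Suc k)) < r / 2"
        using reals_Archimedean[of "r / 2"] r by auto
      \<comment> \<open>The tolerance \<open>2 * e\<close> leaves \<open>e\<close> for the
        oscillation of \<omega> on a cell and \<open>e\<close> for rounding to a rational. Two
        members of one set \<open>C\<close> then differ by at most \<open>4 * e\<close>, which the
        choice of \<open>k\<close> puts below \<open>r\<close>.\<close>
      define e where "e = 1 / (2 * real (Suc k))"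
      have e: "e > 0" "2 * e = 1 / real (Suc k)" "4 * e < r"
        using k by (auto simp: e_def field_simps)
      have "uniformly_continuous_on T \<omega>"
        using compact_uniformly_continuous[OF CT_continuous[OF \<omega>] compact_T] .
      then obtain \<delta> where \<delta>: "\<delta> > 0" "\<And>s t. s \<in> T \<Longrightarrow> t \<in> T \<Longrightarrow> \<bar>t - s\<bar> < \<delta> \<Longrightarrow> \<bar>\<omega> t - \<omega> s\<bar> < e"
        using e(1) unfolding uniformly_continuous_on_def dist_real_def by metis
      obtain N' where N': "inverse (real (Suc N')) < \<delta>" using reals_Archimedean \<delta>(1) by blast
      define N where "N = Suc N'"
      have N: "N > 0" "1 < real N * \<delta>"
        using N' by (auto simp: N_def field_simps)
      define cell where "cell t = nat \<lfloor>real N * t\<rfloor>" for t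
      have cell_close: "\<bar>t - s\<bar> < \<delta>" if "cell s = cell t" "s \<in> T" "t \<in> T" for s t
      proof -
        have "0 \<le> real N * s" "0 \<le> real N * t" using that T_bounds by auto
        then have "\<lfloor>real N * s\<rfloor> = \<lfloor>real N * t\<rfloor>"
          using that(1) by (simp add: cell_def nat_eq_iff split: if_splits)
        then have "\<bar>real N * t - real N * s\<bar> < 1" by linarith
        then have "real N * \<bar>t - s\<bar> < real N * \<delta>"
          using N(2) by (simp add: right_diff_distrib[symmetric] abs_mult)
        then show ?thesis using N(1) by simp
      qed
      \<comment> \<open>The time 1 lies in cell \<open>N\<close>, so there are \<open>N + 1\<close>
        cells, which is the length of the list \<open>q\<close> below.\<close>
      have cell_le: "cell t < Suc N" if "t \<in> T" for t
      proof -
        have "real N * t \<le> real N" using T_bounds[OF that] by (simp add: mult_left_le)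
        then show ?thesis unfolding cell_def by linarith
      qed
      have "\<exists>c :: rat. \<forall>t\<in>T. cell t = j \<longrightarrow> \<bar>\<omega> t - real_of_rat c\<bar> \<le> 2 * e" for j
      proof (cases "\<exists>s\<in>T. cell s = j")
        case True
        then obtain s where s: "s \<in> T" "cell s = j" by blast
        obtain c where c: "\<omega> s - e < real_of_rat c" "real_of_rat c < \<omega> s + e"
          using of_rat_dense[of "\<omega> s - e" "\<omega> s + e"] e(1) by auto
        have "\<bar>\<omega> t - real_of_rat c\<bar> \<le> 2 * e" if "t \<in> T" "cell t = j" for t
          using \<delta>(2)[OF s(1) that(1) cell_close] s that c by (auto simp: abs_if split: if_splits)
        then show ?thesis by blast
      qed auto
      then obtain c :: "nat \<Rightarrow> rat" where
        c: "\<And>j t. t \<in> T \<Longrightarrow> cell t = j \<Longrightarrow> \<bar>\<omega> t - real_of_rat (c j)\<bar> \<le> 2 * e"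
        by metis
      define q where "q = map c [0..<Suc N]"
      have q: "\<bar>\<omega> (d i) - real_of_rat (q ! cell (d i))\<bar> \<le> 2 * e" for i
      proof -
        have "q ! cell (d i) = c (cell (d i))"
          unfolding q_def using cell_le[OF d_T, of i] by (simp del: upt_Suc)
        then show ?thesis using c[OF d_T refl, of i] by simp
      qed
      have "\<omega> \<in> C (N, q, k)"
        using q \<omega> e(2) by (simp add: C_def cell_def)
      moreover have "C (N, q, k) \<subseteq> U"
      proof
        fix \<omega>' assume \<omega>': "\<omega>' \<in> C (N, q, k)"
        then have "\<omega>' \<in> CT T" by (simp add: C_def)
        moreover have "\<bar>\<omega> (d i) - \<omega>' (d i)\<bar> \<le> 4 * e" for i
        proof -
          have "\<bar>\<omega>' (d i) - real_of_rat (q ! cell (d i))\<bar> \<le> 2 * e"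
            using \<omega>' e(2) by (simp add: C_def cell_def)
          then show ?thesis using q[of i] by linarith
        qed
        then have "mdist (CT_metric T) \<omega> \<omega>' \<le> 4 * e"
          by (intro mdist_CT_le_dense \<omega> \<open>\<omega>' \<in> CT T\<close>)
        ultimately show "\<omega>' \<in> U" using r(2) e(3) by auto
      qed
      ultimately show "\<omega> \<in> (\<Union>z\<in>{z. C z \<subseteq> U}. C z)" by blast
    qed
  qed auto
  moreover have "(\<Union>z\<in>{z. C z \<subseteq> U}. C z) \<in> sets M"
    using C_sets by (intro sets.countable_UN') (auto intro: countable_subset[OF subset_UNIV])
  ultimately show ?thesis by simp
qed

text \<open>By \<open>openin_CT_mem_sets\<close>, every open set already lies in the sigma-algebra
  \<open>V\<close> pulled back from real sequences, so measurability into the path space is a matter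
  of the coordinates.\<close>

lemma measurable_borel_CT:
  assumes f: "f \<in> space M \<rightarrow> CT T" and "\<And>i. (\<lambda>x. f x (d i)) \<in> borel_measurable M"
  shows "f \<in> measurable M (borel_CT T)"
  unfolding borel_CT_def
proof (rule measurable_measure_of)
  show "{U. openin (mtopology_of (CT_metric T)) U} \<subseteq> Pow (CT T)"
    using openin_CT by auto
  fix U assume "U \<in> {U. openin (mtopology_of (CT_metric T)) U}"
  moreover define V where "V = vimage_algebra (CT T) (\<lambda>\<omega> i. \<omega> (d i)) (borel :: (nat \<Rightarrow> real) measure)"
  have sV: "space V = CT T" by (simp add: V_def)
  have "(\<lambda>\<omega> i. \<omega> (d i)) \<in> measurable V borel"
    unfolding V_def by (rule measurable_vimage_algebra1) auto
  then have "(\<lambda>\<omega>. \<omega> (d i)) \<in> borel_measurable V" for i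
    by (rule measurable_product_then_coordinatewise)
  ultimately have "U \<in> sets V" by (intro openin_CT_mem_sets) (auto simp: sV)
  then obtain A :: "(nat \<Rightarrow> real) set" where A: "A \<in> sets borel" "U = (\<lambda>\<omega> i. \<omega> (d i)) -` A \<inter> CT T"
    unfolding V_def by (subst (asm) sets_vimage_algebra2) auto
  have "(\<lambda>x i. f x (d i)) \<in> borel_measurable M"
    using assms(2) by (rule measurable_coordinatewise_then_product)
  from measurable_sets[OF this A(1)] show "f -` U \<inter> space M \<in> sets M"
  proof (rule back_subst[of "\<lambda>X. X \<in> sets M"])
    show "(\<lambda>x i. f x (d i)) -` A \<inter> space M = f -` U \<inter> space M" using A(2) f by auto
  qed
qed (rule f)

text \<open>It allows null sets of paths to be compared in the space of sequences, which is Polish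
  and where Borel measures are regular.\<close>

lemma sets_borel_CT_obtain:
  assumes "A \<in> sets (borel_CT T)"
  obtains A' :: "(nat \<Rightarrow> real) set" where "A' \<in> sets borel" "A = (\<lambda>\<omega> i. \<omega> (d i)) -` A' \<inter> CT T"
proof -
  define V where "V = vimage_algebra (CT T) (\<lambda>\<omega> i. \<omega> (d i)) (borel :: (nat \<Rightarrow> real) measure)"
  have sV: "space V = CT T" by (simp add: V_def)
  have "(\<lambda>\<omega> i. \<omega> (d i)) \<in> measurable V borel"
    unfolding V_def by (rule measurable_vimage_algebra1) auto
  then have "(\<lambda>\<omega>. \<omega> (d i)) \<in> borel_measurable V" for i
    by (rule measurable_product_then_coordinatewise)
  then have "(\<lambda>\<omega>. \<omega>) \<in> measurable V (borel_CT T)"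
    by (intro measurable_borel_CT) (auto simp: sV)
  from measurable_sets[OF this assms] have "A \<in> sets V"
    using sets.sets_into_space[OF assms] by (simp add: sV Int_absorb2)
  then show ?thesis
    unfolding V_def by (subst (asm) sets_vimage_algebra2) (auto intro: that)
qed

lemma measurable_coordinates: "(\<lambda>\<omega> i. \<omega> (d i)) \<in> borel_measurable (borel_CT T)"
  by (rule measurable_coordinatewise_then_product) (simp add: d_T measurable_eval)

lemma tau_mem_CT:
  assumes "\<omega> \<in> CT T" "u \<omega> \<in> CT T"
  shows "tau T u \<omega> \<in> CT T"
  unfolding tau_def using assms
  by (intro restrict_mem_CT continuous_intros CT_continuous) (auto simp: CT_zero)

lemma measurable_tau:
  assumes u: "u \<in> measurable (borel_CT T) (borel_CT T)"
  shows "tau T u \<in> measurable (borel_CT T) (borel_CT T)"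
proof (rule measurable_borel_CT)
  show "tau T u \<in> space (borel_CT T) \<rightarrow> CT T"
    using measurable_space[OF u] by (auto intro: tau_mem_CT)
  show "(\<lambda>\<omega>. tau T u \<omega> (d i)) \<in> borel_measurable (borel_CT T)" for i
    using measurable_eval[OF d_T] measurable_compose[OF u measurable_eval[OF d_T]]
    by (simp add: tau_def d_T)
qed

end

section \<open>Sampled Wiener measure\<close>

lemma finite_increasing_enumeration:
  fixes Q :: "real set"
  assumes "finite Q" "Q \<noteq> {}"
  obtains p :: "nat \<Rightarrow> real" and n where "p ` {..n} = Q" "\<And>i. i < n \<Longrightarrow> p i < p (Suc i)"
proof
  let ?L = "sorted_list_of_set Q" and ?n = "card Q - 1"
  have card: "card Q > 0" using assms by (simp add: card_gt_0_iff)
  have "(!) ?L ` {..?n} = (!) ?L ` {..<length ?L}"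
    using card by (intro arg_cong[where f = "\<lambda>X. (!) ?L ` X"]) auto
  also have "\<dots> = Q"
  proof -
    have "(!) ?L ` {..<length ?L} = set ?L" by (auto simp: set_conv_nth)
    then show ?thesis using assms by simp
  qed
  finally show "(!) ?L ` {..?n} = Q" .
  show "?L ! i < ?L ! Suc i" if "i < ?n" for i
    using that strict_sorted_list_of_set[of Q] by (auto simp: sorted_wrt_iff_nth_less)
qed

lemma strict_increasing_initial:
  fixes p :: "nat \<Rightarrow> real"
  assumes "\<And>i. i < n \<Longrightarrow> p i < p (Suc i)" "i < j" "j \<le> n"
  shows "p i < p j"
  using assms(2,3)
proof (induction j)
  case (Suc j)
  then show ?case using assms(1)[of j] by (cases "i = j") auto
qed simp

locale sampled_wiener = time_scale T d for T d +
  fixes M :: "'a measure" and B :: "real \<Rightarrow> 'a \<Rightarrow> real"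
  assumes brownian: "standard_brownian_motion M B"
begin

definition \<mu> :: "(real \<Rightarrow> real) measure" where "\<mu> = sampled_law T M B"

text \<open>The augmented filtration contains the null sets of the completion, so its members are
  events for \<open>\<mu>c\<close> but in general not for \<open>\<mu>\<close>.\<close>

definition \<mu>c :: "(real \<Rightarrow> real) measure" where "\<mu>c = completion \<mu>"

sublocale M: prob_space M
  using brownian by (simp add: standard_brownian_motion_def)

lemma B_measurable: "t \<in> T \<Longrightarrow> B t \<in> borel_measurable M"
  using brownian T_bounds by (simp add: standard_brownian_motion_def)

lemma B_zero: "\<omega> \<in> space M \<Longrightarrow> B 0 \<omega> = 0"
  using brownian by (simp add: standard_brownian_motion_def)

lemma sampling_measurable: "(\<lambda>\<omega>. \<lambda>t\<in>T. B t \<omega>) \<in> measurable M (borel_CT T)"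
proof (rule measurable_borel_CT)
  have "continuous_on T (\<lambda>t. B t \<omega>)" if "\<omega> \<in> space M" for \<omega>
    using brownian that T_subset unfolding standard_brownian_motion_def
    by (meson continuous_on_subset)
  then show "(\<lambda>\<omega>. \<lambda>t\<in>T. B t \<omega>) \<in> space M \<rightarrow> CT T"
    by (auto intro!: restrict_mem_CT B_zero)
qed (simp add: B_measurable d_T)

lemma sets_\<mu> [simp, measurable_cong]: "sets \<mu> = sets (borel_CT T)"
  and space_\<mu> [simp]: "space \<mu> = CT T"
  by (simp_all add: \<mu>_def sampled_law_def)

lemma space_\<mu>c [simp]: "space \<mu>c = CT T"
  by (simp add: \<mu>c_def)

lemma prob_space_\<mu>: "prob_space \<mu>"
  unfolding \<mu>_def sampled_law_def by (rule M.prob_space_distr[OF sampling_measurable])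

sublocale \<mu>c: prob_space \<mu>c
  using prob_space.emeasure_space_1[OF prob_space_\<mu>] sets.top[of "borel_CT T"]
  by (intro prob_spaceI) (simp add: \<mu>c_def)

lemma measurable_\<mu>_\<mu>c: "f \<in> measurable (borel_CT T) N \<Longrightarrow> f \<in> measurable \<mu>c N"
  unfolding \<mu>c_def by (rule measurable_completion) (simp cong: measurable_cong_sets)

lemma sets_borel_CT_\<mu>c: "A \<in> sets (borel_CT T) \<Longrightarrow> A \<in> sets \<mu>c"
  by (simp add: \<mu>c_def)

lemma measure_\<mu>c:
  assumes "A \<in> sets (borel_CT T)"
  shows "measure \<mu>c A = measure M {\<omega> \<in> space M. (\<lambda>t\<in>T. B t \<omega>) \<in> A}"
proof -
  have "measure \<mu>c A = measure \<mu> A"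
    using assms by (simp add: \<mu>c_def)
  also have "\<dots> = measure M ((\<lambda>\<omega>. \<lambda>t\<in>T. B t \<omega>) -` A \<inter> space M)"
    unfolding \<mu>_def sampled_law_def by (rule measure_distr[OF sampling_measurable assms])
  finally show ?thesis by (simp add: vimage_def Int_def conj_commute)
qed

lemma increment_measurable:
  "s \<in> T \<Longrightarrow> t \<in> T \<Longrightarrow> (\<lambda>\<omega>. \<omega> t - \<omega> s) \<in> borel_measurable (borel_CT T)"
  using measurable_eval by (intro borel_measurable_diff)

lemma distr_increment:
  assumes st: "s \<in> T" "t \<in> T" "s < t"
  shows "distr \<mu>c borel (\<lambda>\<omega>. \<omega> t - \<omega> s) = density lborel (normal_density 0 (sqrt (t - s)))"
proof -
  have "distr \<mu>c borel (\<lambda>\<omega>. \<omega> t - \<omega> s) = distr \<mu> borel (\<lambda>\<omega>. \<omega> t - \<omega> s)"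
    unfolding \<mu>c_def using increment_measurable[OF st(1,2)] by (intro distr_completion) simp
  also have "\<dots> = distr M borel ((\<lambda>\<omega>. \<omega> t - \<omega> s) \<circ> (\<lambda>\<omega>. \<lambda>t\<in>T. B t \<omega>))"
    unfolding \<mu>_def sampled_law_def
    by (rule distr_distr[OF increment_measurable[OF st(1,2)] sampling_measurable])
  also have "\<dots> = distr M lborel (\<lambda>\<omega>. B t \<omega> - B s \<omega>)"
    using st by (intro distr_cong) auto
  also have "\<dots> = density lborel (normal_density 0 (sqrt (t - s)))"
  proof (rule distributed_distr_eq_density)
    show "distributed M lborel (\<lambda>\<omega>. B t \<omega> - B s \<omega>) (\<lambda>x. ennreal (normal_density 0 (sqrt (t - s)) x))"
      using brownian st T_bounds unfolding standard_brownian_motion_def by simp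
  qed
  finally show ?thesis .
qed

text \<open>A Brownian motion is given with independent increments along finite partitions only. So
  the past times are completed to a partition that ends with \<open>s\<close> and \<open>t\<close>;
  the past values are partial sums of the earlier increments.\<close>

lemma increment_indep_of_past_cylinder:
  assumes st: "s \<in> T" "t \<in> T" "s < t" and R: "finite R" "R \<subseteq> {0..s} \<inter> T"
    and A: "\<And>r. A r \<in> sets borel" and C: "C \<in> sets borel"
  shows "M.prob {\<omega>\<in>space M. (\<forall>r\<in>R. B r \<omega> \<in> A r) \<and> B t \<omega> - B s \<omega> \<in> C} =
    M.prob {\<omega>\<in>space M. \<forall>r\<in>R. B r \<omega> \<in> A r} * M.prob {\<omega>\<in>space M. B t \<omega> - B s \<omega> \<in> C}"
proof -
  \<comment> \<open>The point 0, where \<open>B\<close> vanishes, turns values of \<open>B\<close>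
    into sums of increments; \<open>s\<close> and \<open>t\<close> single out the increment in
    question.\<close>
  define Q where "Q = R \<union> {0, s, t}"
  obtain p n where p: "p ` {..n} = Q" "\<And>i. i < n \<Longrightarrow> p i < p (Suc i)"
    using finite_increasing_enumeration[of Q] R(1) by (auto simp: Q_def)
  have p_less: "p i < p j" if "i < j" "j \<le> n" for i j
    using strict_increasing_initial[of n p i j] p(2) that by blast
  have p_Q: "p i \<in> Q" if "i \<le> n" for i using p(1) that by blast
  have Q_T: "Q \<subseteq> T" using R st zero_T by (auto simp: Q_def)
  have idx: "\<exists>i\<le>n. p i = x" if "x \<in> Q" for x using that p(1) by (auto simp: image_iff)
  have Q_bounds: "x = t \<or> x \<le> s" "0 \<le> x" if "x \<in> Q" for x
    using that R st T_bounds by (auto simp: Q_def)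
  have p0: "p 0 = 0"
  proof -
    obtain i where "i \<le> n" "p i = 0" using idx[of 0] by (auto simp: Q_def)
    then show ?thesis using p_less[of 0 i] Q_bounds(2)[OF p_Q[of 0]] by (cases "i = 0") auto
  qed
  have pn: "p n = t"
  proof -
    obtain i where "i \<le> n" "p i = t" using idx[of t] by (auto simp: Q_def)
    then show ?thesis using p_less[of i n] Q_bounds(1)[OF p_Q[of n]] st by (cases "i = n") auto
  qed
  obtain k where k: "k \<le> n" "p k = s" using idx[of s] by (auto simp: Q_def)
  \<comment> \<open>Every point of \<open>Q\<close> except \<open>t\<close> is at most
    \<open>s\<close>, so \<open>s\<close> is the last but one.\<close>
  have n: "n = Suc k"
  proof -
    have "k \<noteq> n" using k pn st by auto
    moreover have False if "Suc k < n"
      using p_less[of k "Suc k"] p_less[of "Suc k" n] Q_bounds(1)[OF p_Q[of "Suc k"]] that k pn by auto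
    ultimately show ?thesis using k(1) by (meson le_neq_implies_less linorder_cases not_less_eq)
  qed
  define \<xi> where "\<xi> i \<omega> = B (p (Suc i)) \<omega> - B (p i) \<omega>" for i \<omega>
  have "M.indep_vars (\<lambda>_. borel) \<xi> {..<n}"
    using brownian p(2) p_Q Q_T T_subset unfolding standard_brownian_motion_def \<xi>_def by blast
  then have indep: "M.indep_var (PiM {..<k} (\<lambda>_. borel)) (\<lambda>\<omega>. restrict (\<lambda>i. \<xi> i \<omega>) {..<k})
      (PiM {k} (\<lambda>_. borel)) (\<lambda>\<omega>. restrict (\<lambda>i. \<xi> i \<omega>) {k})"
    by (rule M.indep_var_restrict) (auto simp: n)
  have B_sum: "B (p j) \<omega> = (\<Sum>i<j. \<xi> i \<omega>)" if "\<omega> \<in> space M" for j \<omega>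
    using sum_lessThan_telescope[of "\<lambda>i. B (p i) \<omega>" j] p0 B_zero[OF that] by (simp add: \<xi>_def)
  have "\<exists>j. j \<le> k \<and> p j = r" if "r \<in> R" for r
  proof -
    have "r \<in> Q" using that by (simp add: Q_def)
    then obtain j where "j \<le> n" "p j = r" using idx by blast
    moreover have "r \<noteq> t" using R that st by auto
    ultimately show ?thesis using pn n by (metis le_SucE)
  qed
  then obtain j where j: "\<And>r. r \<in> R \<Longrightarrow> j r \<le> k \<and> p (j r) = r" by metis
  define S1 where "S1 = {x \<in> space (PiM {..<k} (\<lambda>_. borel)). \<forall>r\<in>R. (\<Sum>i<j r. x i) \<in> A r}"
  define S2 where "S2 = {x \<in> space (PiM {k} (\<lambda>_. borel :: real measure)). x k \<in> C}"
  have "(\<lambda>x. \<Sum>i<j r. x i) \<in> borel_measurable (PiM {..<k} (\<lambda>_. borel :: real measure))" if "r \<in> R" for r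
    using j[OF that] by (intro borel_measurable_sum measurable_component_singleton) auto
  then have S1: "S1 \<in> sets (PiM {..<k} (\<lambda>_. borel))"
    unfolding S1_def using R(1) A
    by (intro sets.sets_Collect_finite_All) (auto intro: measurable_sets_Collect)
  have S2: "S2 \<in> sets (PiM {k} (\<lambda>_. borel))"
    unfolding S2_def using C by measurable
  have E1: "{\<omega>\<in>space M. \<forall>r\<in>R. B r \<omega> \<in> A r} = (\<lambda>\<omega>. restrict (\<lambda>i. \<xi> i \<omega>) {..<k}) -` S1 \<inter> space M"
  proof -
    have "(\<Sum>i<j r. restrict (\<lambda>i. \<xi> i \<omega>) {..<k} i) = B r \<omega>" if "r \<in> R" "\<omega> \<in> space M" for r \<omega>
    proof -
      have "(\<Sum>i<j r. restrict (\<lambda>i. \<xi> i \<omega>) {..<k} i) = (\<Sum>i<j r. \<xi> i \<omega>)"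
        using j[OF that(1)] by (intro sum.cong) auto
      then show ?thesis using B_sum[OF that(2), of "j r"] j[OF that(1)] by simp
    qed
    then show ?thesis by (auto simp: S1_def space_PiM)
  qed
  have E2: "{\<omega>\<in>space M. B t \<omega> - B s \<omega> \<in> C} = (\<lambda>\<omega>. restrict (\<lambda>i. \<xi> i \<omega>) {k}) -` S2 \<inter> space M"
    using k pn n by (auto simp: S2_def \<xi>_def space_PiM)
  have E12: "{\<omega>\<in>space M. (\<forall>r\<in>R. B r \<omega> \<in> A r) \<and> B t \<omega> - B s \<omega> \<in> C} =
    {\<omega>\<in>space M. \<forall>r\<in>R. B r \<omega> \<in> A r} \<inter> {\<omega>\<in>space M. B t \<omega> - B s \<omega> \<in> C}"
    by auto
  show ?thesis
    unfolding E12 using M.indep_varD[OF indep S1 S2] unfolding E1 E2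
    by (simp add: vimage_def Int_def conj_ac)
qed

section \<open>The augmented filtration and its independence from later increments\<close>

abbreviation "F \<equiv> filt T \<mu>"

lemma filt_generators_subset:
  "{W r -` A \<inter> CT T | r A. r \<in> {0..s} \<inter> T \<and> A \<in> sets borel} \<union> null_sets (completion \<mu>) \<subseteq> Pow (CT T)"
  using sets.sets_into_space[of _ "completion \<mu>"] by (auto simp: null_sets_def)

lemma space_filt [simp]: "space (F s) = CT T"
  unfolding filt_def using filt_generators_subset by (rule space_measure_of)

lemma sets_filt: "sets (F s) = sigma_sets (CT T)
    ({W r -` A \<inter> CT T | r A. r \<in> {0..s} \<inter> T \<and> A \<in> sets borel} \<union> null_sets (completion \<mu>))"
  unfolding filt_def using filt_generators_subset by (rule sets_measure_of)

lemma sets_filt_mono: "s \<le> t \<Longrightarrow> sets (F s) \<subseteq> sets (F t)"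
  unfolding sets_filt by (intro sigma_sets_mono') fastforce

lemma eval_filt:
  assumes "r \<in> T" "r \<le> s"
  shows "(\<lambda>\<omega>. \<omega> r) \<in> borel_measurable (F s)"
proof (rule measurableI)
  fix A :: "real set" assume "A \<in> sets borel"
  then have "W r -` A \<inter> CT T \<in> sets (F s)"
    unfolding sets_filt using assms T_bounds by (intro sigma_sets.Basic) auto
  then show "(\<lambda>\<omega>. \<omega> r) -` A \<inter> space (F s) \<in> sets (F s)"
    by (simp add: W_def vimage_def)
qed simp

text \<open>The evaluation sets that generate \<open>filt\<close> restrict one time each and are not
  stable under intersection; conditions at finitely many times are.\<close>

definition cylinders :: "real \<Rightarrow> (real \<Rightarrow> real) set set" where
  "cylinders s = {{\<omega>\<in>CT T. \<forall>r\<in>R. \<omega> r \<in> A r} | R A. finite R \<and> R \<subseteq> {0..s} \<inter> T \<and> (\<forall>r. A r \<in> sets borel)}"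

lemma cylinders_Int:
  assumes "X \<in> cylinders s" "Y \<in> cylinders s"
  shows "X \<inter> Y \<in> cylinders s"
proof -
  obtain R A where X: "X = {\<omega>\<in>CT T. \<forall>r\<in>R. \<omega> r \<in> A r}" "finite R" "R \<subseteq> {0..s} \<inter> T" "\<forall>r. A r \<in> sets borel"
    using assms(1) unfolding cylinders_def by blast
  obtain R' A' where Y: "Y = {\<omega>\<in>CT T. \<forall>r\<in>R'. \<omega> r \<in> A' r}" "finite R'" "R' \<subseteq> {0..s} \<inter> T" "\<forall>r. A' r \<in> sets borel"
    using assms(2) unfolding cylinders_def by blast
  have "X \<inter> Y = {\<omega>\<in>CT T. \<forall>r\<in>R \<union> R'. \<omega> r \<in> (if r \<in> R then A r else UNIV) \<inter> (if r \<in> R' then A' r else UNIV)}"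
    unfolding X(1) Y(1) by auto
  then show ?thesis
    unfolding cylinders_def using X(2-4) Y(2-4)
    by (intro CollectI exI[of _ "R \<union> R'"] exI[of _ "\<lambda>r. (if r \<in> R then A r else UNIV) \<inter> (if r \<in> R' then A' r else UNIV)"]) auto
qed

lemma cylinders_sets: "X \<in> cylinders s \<Longrightarrow> X \<in> sets (borel_CT T)"
proof -
  assume "X \<in> cylinders s"
  then obtain R A where X: "X = {\<omega>\<in>space (borel_CT T). \<forall>r\<in>R. \<omega> r \<in> A r}" "finite R" "R \<subseteq> {0..s} \<inter> T" "\<forall>r. A r \<in> sets borel"
    unfolding cylinders_def by auto
  show ?thesis
    unfolding X(1) using X(2-4)
    by (intro sets.sets_Collect_finite_All) (auto intro!: measurable_sets_Collect[OF measurable_eval] simp del: space_borel_CT)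
qed

text \<open>Adjoining the null sets to the cylinders keeps them stable under intersection, so independence
  extends from this generator to the augmented filtration.\<close>

lemma indep_filt_increment:
  assumes st: "s \<in> T" "t \<in> T" "s < t"
  shows "\<mu>c.indep_set (sets (F s)) (sigma_sets (CT T) {(\<lambda>\<omega>. \<omega> t - \<omega> s) -` C \<inter> CT T | C. C \<in> sets borel})"
proof -
  let ?P = "cylinders s \<union> null_sets \<mu>c"
  let ?Q = "{(\<lambda>\<omega>. \<omega> t - \<omega> s) -` C \<inter> CT T | C. C \<in> sets (borel :: real measure)}"
  have Q_sets: "Y \<in> sets (borel_CT T)" if "Y \<in> ?Q" for Y
    using that measurable_sets[OF increment_measurable[OF st(1,2)]] by auto
  have ind: "\<mu>c.indep_set ?P ?Q"
    unfolding \<mu>c.indep_sets2_eq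
  proof (intro conjI ballI)
    show "?P \<subseteq> \<mu>c.events" using cylinders_sets sets_borel_CT_\<mu>c by auto
    show "?Q \<subseteq> \<mu>c.events" using Q_sets sets_borel_CT_\<mu>c by auto
    fix X Y assume X: "X \<in> ?P" and Y: "Y \<in> ?Q"
    obtain C where C: "C \<in> sets borel" "Y = (\<lambda>\<omega>. \<omega> t - \<omega> s) -` C \<inter> CT T" using Y by blast
    show "\<mu>c.prob (X \<inter> Y) = \<mu>c.prob X * \<mu>c.prob Y"
    proof (cases "X \<in> null_sets \<mu>c")
      case True
      then have "X \<inter> Y \<in> null_sets \<mu>c"
        using Q_sets[OF Y] sets_borel_CT_\<mu>c by (intro null_set_Int2) auto
      then show ?thesis using True by (simp add: null_sets_def measure_def)
    next
      case False
      with X obtain R A where R: "X = {\<omega>\<in>CT T. \<forall>r\<in>R. \<omega> r \<in> A r}" "finite R" "R \<subseteq> {0..s} \<inter> T" "\<And>r. A r \<in> sets borel"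
        unfolding cylinders_def by blast
      have X_sets: "X \<in> sets (borel_CT T)" using X False cylinders_sets by blast
      have samp: "(\<lambda>t\<in>T. B t \<omega>) \<in> CT T" if "\<omega> \<in> space M" for \<omega>
        using measurable_space[OF sampling_measurable that] by simp
      have RT: "r \<in> T" if "r \<in> R" for r using R that by auto
      have "\<mu>c.prob X = M.prob {\<omega>\<in>space M. \<forall>r\<in>R. B r \<omega> \<in> A r}"
        unfolding measure_\<mu>c[OF X_sets] using samp RT
        by (intro arg_cong[where f = M.prob]) (auto simp: R(1))
      moreover have "\<mu>c.prob Y = M.prob {\<omega>\<in>space M. B t \<omega> - B s \<omega> \<in> C}"
        unfolding measure_\<mu>c[OF Q_sets[OF Y]] using samp st
        by (intro arg_cong[where f = M.prob]) (auto simp: C(2))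
      moreover have "\<mu>c.prob (X \<inter> Y) = M.prob {\<omega>\<in>space M. (\<forall>r\<in>R. B r \<omega> \<in> A r) \<and> B t \<omega> - B s \<omega> \<in> C}"
        unfolding measure_\<mu>c[OF sets.Int[OF X_sets Q_sets[OF Y]]] using samp st RT
        by (intro arg_cong[where f = M.prob]) (auto simp: R(1) C(2))
      ultimately show ?thesis
        using increment_indep_of_past_cylinder[OF st R(2,3,4) C(1)] by simp
    qed
  qed
  have "Int_stable ?P"
  proof (rule Int_stableI)
    fix X Y assume XY: "X \<in> ?P" "Y \<in> ?P"
    then have "X \<in> sets \<mu>c" "Y \<in> sets \<mu>c" using cylinders_sets sets_borel_CT_\<mu>c by auto
    then show "X \<inter> Y \<in> ?P"
      using XY cylinders_Int null_set_Int1[of X \<mu>c Y] null_set_Int2[of Y \<mu>c X] by (auto simp: Int_commute)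
  qed
  moreover have "Int_stable ?Q"
  proof (rule Int_stableI)
    fix X Y assume "X \<in> ?Q" "Y \<in> ?Q"
    then obtain C D where "X = (\<lambda>\<omega>. \<omega> t - \<omega> s) -` C \<inter> CT T" "Y = (\<lambda>\<omega>. \<omega> t - \<omega> s) -` D \<inter> CT T"
      and CD: "C \<in> sets borel" "D \<in> sets borel" by blast
    then have "X \<inter> Y = (\<lambda>\<omega>. \<omega> t - \<omega> s) -` (C \<inter> D) \<inter> CT T" by auto
    then show "X \<inter> Y \<in> ?Q" using CD by blast
  qed
  ultimately have indep: "\<mu>c.indep_set (sigma_sets (CT T) ?P) (sigma_sets (CT T) ?Q)"
    using \<mu>c.indep_set_sigma_sets[OF ind] by simp
  have sub: "sets (F s) \<subseteq> sigma_sets (CT T) ?P"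
    unfolding sets_filt \<mu>c_def
  proof (intro sigma_sets_mono' Un_mono subsetI order_refl)
    fix X assume "X \<in> {W r -` A \<inter> CT T | r A. r \<in> {0..s} \<inter> T \<and> A \<in> sets borel}"
    then obtain r A where "X = W r -` A \<inter> CT T" "r \<in> {0..s} \<inter> T" "A \<in> sets borel" by blast
    then show "X \<in> cylinders s"
      unfolding cylinders_def by (intro CollectI exI[of _ "{r}"] exI[of _ "\<lambda>_. A"]) (auto simp: W_def)
  qed
  show ?thesis
    unfolding \<mu>c.indep_sets2_eq
  proof (intro conjI ballI)
    show "sets (F s) \<subseteq> \<mu>c.events" using \<mu>c.indep_setD_ev1[OF indep] sub by (rule order_trans[rotated])
    show "sigma_sets (CT T) ?Q \<subseteq> \<mu>c.events" by (rule \<mu>c.indep_setD_ev2[OF indep])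
    show "\<mu>c.prob (X \<inter> Y) = \<mu>c.prob X * \<mu>c.prob Y"
      if "X \<in> sets (F s)" "Y \<in> sigma_sets (CT T) ?Q" for X Y
      using \<mu>c.indep_setD[OF indep subsetD[OF sub that(1)] that(2)] .
  qed
qed

lemma sets_filt_subset: "sets (F s) \<subseteq> sets \<mu>c"
proof -
  have "{W r -` A \<inter> CT T | r A. r \<in> {0..s} \<inter> T \<and> A \<in> sets borel} \<union> null_sets (completion \<mu>) \<subseteq> sets \<mu>c"
  proof (intro Un_least subsetI)
    fix X assume "X \<in> {W r -` A \<inter> CT T | r A. r \<in> {0..s} \<inter> T \<and> A \<in> sets borel}"
    then obtain r A where X: "X = W r -` A \<inter> CT T" "r \<in> T" "A \<in> sets borel" by blast
    have "W r = (\<lambda>\<omega>. \<omega> r)" by (simp add: fun_eq_iff W_def)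
    then have "X \<in> sets (borel_CT T)"
      using measurable_sets[OF measurable_eval[OF X(2)] X(3)] X(1) by simp
    then show "X \<in> sets \<mu>c" by (rule sets_borel_CT_\<mu>c)
  qed (auto simp: \<mu>c_def)
  then show ?thesis
    unfolding sets_filt using sets.sigma_sets_subset[of _ \<mu>c] by simp
qed

text \<open>Independence gives agreement on rectangles, which determine a product of sigma-finite
  measures. This is the form in which \<open>gaussian_innovations\<close> asks for
  independence.\<close>

lemma innovation:
  assumes st: "s \<in> T" "t \<in> T" "s < t"
  shows "distr \<mu>c (F s \<Otimes>\<^sub>M borel) (\<lambda>\<omega>. (\<omega>, \<omega> t - \<omega> s)) =
    distr \<mu>c (F s) (\<lambda>\<omega>. \<omega>) \<Otimes>\<^sub>M density lborel (normal_density 0 (sqrt (t - s)))"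
proof -
  have id_F: "(\<lambda>\<omega>. \<omega>) \<in> measurable \<mu>c (F s)"
  proof (rule measurableI)
    show "(\<lambda>\<omega>. \<omega>) -` A \<inter> space \<mu>c \<in> sets \<mu>c" if "A \<in> sets (F s)" for A
      using subsetD[OF sets_filt_subset that] sets.Int_space_eq2[of A \<mu>c] by simp
  qed simp
  have incr: "(\<lambda>\<omega>. \<omega> t - \<omega> s) \<in> borel_measurable \<mu>c"
    by (rule measurable_\<mu>_\<mu>c[OF increment_measurable[OF st(1,2)]])
  let ?D = "distr \<mu>c borel (\<lambda>\<omega>. \<omega> t - \<omega> s)"
  have "distr \<mu>c (F s) (\<lambda>\<omega>. \<omega>) \<Otimes>\<^sub>M ?D = distr \<mu>c (F s \<Otimes>\<^sub>M borel) (\<lambda>\<omega>. (\<omega>, \<omega> t - \<omega> s))"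
  proof (rule pair_measure_eqI)
    show "sigma_finite_measure (distr \<mu>c (F s) (\<lambda>\<omega>. \<omega>))" "sigma_finite_measure ?D"
      using \<mu>c.prob_space_distr[OF id_F] \<mu>c.prob_space_distr[OF incr]
      by (simp_all add: prob_space_imp_sigma_finite)
    fix A C assume "A \<in> sets (distr \<mu>c (F s) (\<lambda>\<omega>. \<omega>))" "C \<in> sets ?D"
    then have A: "A \<in> sets (F s)" and C: "C \<in> sets borel" by auto
    let ?C = "(\<lambda>\<omega>. \<omega> t - \<omega> s) -` C \<inter> CT T"
    have A_space: "A \<inter> CT T = A" using sets.Int_space_eq2[OF A] by simp
    have "emeasure (distr \<mu>c (F s) (\<lambda>\<omega>. \<omega>)) A * emeasure ?D C = ennreal (\<mu>c.prob A * \<mu>c.prob ?C)"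
      using A C A_space by (simp add: emeasure_distr[OF id_F] emeasure_distr[OF incr] \<mu>c.emeasure_eq_measure ennreal_mult)
    also have "\<mu>c.prob A * \<mu>c.prob ?C = \<mu>c.prob (A \<inter> ?C)"
      using C by (intro \<mu>c.indep_setD[OF indep_filt_increment[OF st] A, symmetric] sigma_sets.Basic) blast
    also have "A \<inter> ?C = (\<lambda>\<omega>. (\<omega>, \<omega> t - \<omega> s)) -` (A \<times> C) \<inter> space \<mu>c"
      using A_space by auto
    also have "ennreal (\<mu>c.prob \<dots>) = emeasure (distr \<mu>c (F s \<Otimes>\<^sub>M borel) (\<lambda>\<omega>. (\<omega>, \<omega> t - \<omega> s))) (A \<times> C)"
      using A C by (subst emeasure_distr[OF measurable_Pair[OF id_F incr]]) (auto simp: \<mu>c.emeasure_eq_measure)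
    finally show "emeasure (distr \<mu>c (F s) (\<lambda>\<omega>. \<omega>)) A * emeasure ?D C =
      emeasure (distr \<mu>c (F s \<Otimes>\<^sub>M borel) (\<lambda>\<omega>. (\<omega>, \<omega> t - \<omega> s))) (A \<times> C)" .
  qed (simp cong: sets_pair_measure_cong)
  then show ?thesis
    unfolding distr_increment[OF st] by simp
qed

end

section \<open>Cameron--Martin paths on a time scale\<close>

lemma integrable_imp_set_integrable:
  fixes f :: "'a \<Rightarrow> 'b :: {banach, second_countable_topology}"
  shows "integrable M f \<Longrightarrow> A \<in> sets M \<Longrightarrow> set_integrable M A f"
  unfolding set_integrable_def by (rule integrable_mult_indicator)

text \<open>Expand the nonnegative integral of the squared deviation of \<open>G\<close> from its
  mean value \<open>c\<close>.\<close>

lemma integral_Ioc_Cauchy_Schwarz: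
  fixes G :: "real \<Rightarrow> real"
  assumes G: "integrable lborel G" and G2: "integrable lborel (\<lambda>r. (G r)\<^sup>2)" and st: "s < t"
  shows "(LINT r:{s<..t}|lborel. G r)\<^sup>2 \<le> (t - s) * (LINT r:{s<..t}|lborel. (G r)\<^sup>2)"
proof -
  define J where "J = (LINT r:{s<..t}|lborel. G r)"
  define A where "A = (LINT r:{s<..t}|lborel. (G r)\<^sup>2)"
  define c where "c = J / (t - s)"
  have int: "set_integrable lborel {s<..t} G" "set_integrable lborel {s<..t} (\<lambda>r. (G r)\<^sup>2)"
    using G G2 by (auto intro: integrable_imp_set_integrable)
  have "0 \<le> (LINT r:{s<..t}|lborel. (G r - c)\<^sup>2)"
    unfolding set_lebesgue_integral_def by (rule Bochner_Integration.integral_nonneg) simp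
  also have "\<dots> = (LINT r|lborel. indicator {s<..t} r * (G r)\<^sup>2 - 2 * c * (indicator {s<..t} r * G r)
      + c\<^sup>2 * indicator {s<..t} r)"
    unfolding set_lebesgue_integral_def
    by (rule arg_cong[where f = "lebesgue_integral lborel"]) (auto simp: fun_eq_iff indicator_def power2_diff)
  also have "\<dots> = A - 2 * c * J + c\<^sup>2 * (t - s)"
    using int st unfolding A_def J_def set_lebesgue_integral_def set_integrable_def by simp
  finally have le: "2 * c * J - c * (c * (t - s)) \<le> A"
    by (simp add: power2_eq_square mult.assoc)
  have J: "c * (t - s) = J" using st by (simp add: c_def)
  have "c * J \<le> A" using le unfolding J by (simp add: mult.commute)
  then have "(t - s) * (c * J) \<le> (t - s) * A"
    using st by (intro mult_left_mono) auto
  moreover have "(t - s) * (c * J) = J\<^sup>2"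
    unfolding power2_eq_square by (subst (3) J[symmetric]) (simp add: mult_ac)
  ultimately show ?thesis by (simp add: A_def J_def)
qed

context time_scale
begin

section \<open>The backward jump \<open>rho_bar\<close> and integrals against
  \<open>lambda_Delta\<close>\<close>

lemma
  assumes "0 \<le> r" "r \<le> 1"
  shows rho_bar_T: "rho_bar T r \<in> T" and rho_bar_le: "rho_bar T r \<le> r"
proof -
  have "rho_bar T r \<in> T \<and> rho_bar T r \<le> r"
  proof (cases "r = 0")
    case False
    let ?S = "{v \<in> T. v < r}"
    have S: "?S \<noteq> {}" "bdd_above ?S" using False assms zero_T by (auto intro!: bdd_aboveI[of _ r])
    have "Sup ?S \<in> closure ?S" using S by (rule closure_contains_Sup)
    moreover have "closure ?S \<subseteq> T" using closed_T by (intro closure_minimal) auto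
    moreover have "Sup ?S \<le> r" using S(1) by (intro cSup_least) auto
    ultimately show ?thesis using False by (auto simp: rho_bar_def)
  qed (simp add: rho_bar_def zero_T)
  then show "rho_bar T r \<in> T" "rho_bar T r \<le> r" by auto
qed

lemma rho_bar_ge: "t \<in> T \<Longrightarrow> t < r \<Longrightarrow> t \<le> rho_bar T r"
  using T_bounds by (auto simp: rho_bar_def intro!: cSup_upper bdd_aboveI[of _ r])

text \<open>It yields Borel measurability of \<open>rho_bar\<close>. If \<open>rho_bar T r\<close>
  is not below \<open>s\<close>, then \<open>rho_bar T r \<le> r \<le> s\<close> forces
  \<open>r = s\<close>.\<close>

lemma rho_bar_mono: "mono_on {0..1} (rho_bar T)"
proof (rule mono_onI)
  fix r s :: real assume rs: "r \<in> {0..1}" "s \<in> {0..1}" "r \<le> s"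
  show "rho_bar T r \<le> rho_bar T s"
  proof (cases "rho_bar T r < s")
    case True
    then show ?thesis using rs by (intro rho_bar_ge rho_bar_T) auto
  next
    case False
    then have "r = s" using rs rho_bar_le[of r] by auto
    then show ?thesis by simp
  qed
qed

lemma rho_bar_measurable: "rho_bar T \<in> measurable (restrict_space lborel {0..1}) (restrict_space borel T)"
proof (rule measurable_restrict_space2)
  show "rho_bar T \<in> space (restrict_space lborel {0..1}) \<rightarrow> T"
    using rho_bar_T by (auto simp: space_restrict_space)
  have "rho_bar T \<in> borel_measurable (restrict_space borel {0..1})"
    by (rule borel_measurable_mono_on_fnc[OF rho_bar_mono])
  then show "rho_bar T \<in> borel_measurable (restrict_space lborel {0..1})"
    by (simp cong: measurable_cong_sets add: sets_restrict_space)
qed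

lemma
  fixes f :: "real \<Rightarrow> real"
  assumes f: "f \<in> borel_measurable (lambda_Delta T)"
  shows integrable_lambda_Delta:
      "integrable (lambda_Delta T) f \<longleftrightarrow> integrable lborel (\<lambda>r. indicator {0..1} r * f (rho_bar T r))"
    and integral_lambda_Delta:
      "(LINT x|lambda_Delta T. f x) = (LINT r|lborel. indicator {0..1} r * f (rho_bar T r))"
proof -
  have f': "f \<in> borel_measurable (restrict_space borel T)"
    using f by (simp add: lambda_Delta_def)
  show "integrable (lambda_Delta T) f \<longleftrightarrow> integrable lborel (\<lambda>r. indicator {0..1} r * f (rho_bar T r))"
    unfolding lambda_Delta_def integrable_distr_eq[OF rho_bar_measurable f']
    by (subst integrable_restrict_space) auto
  show "(LINT x|lambda_Delta T. f x) = (LINT r|lborel. indicator {0..1} r * f (rho_bar T r))"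
    unfolding lambda_Delta_def integral_distr[OF rho_bar_measurable f']
    by (subst integral_restrict_space) auto
qed

definition lower :: "real \<Rightarrow> real" where
  "lower s = Sup {v \<in> T. v \<le> s}"

lemma
  assumes "0 \<le> s"
  shows lower_T: "lower s \<in> T" and lower_le: "lower s \<le> s"
proof -
  let ?S = "{v \<in> T. v \<le> s}"
  have S: "?S \<noteq> {}" "bdd_above ?S" using assms zero_T by (auto intro!: bdd_aboveI[of _ s])
  have "closed ?S" using closed_T closed_Int[OF closed_T closed_atMost[of s]]
    by (simp add: Int_def)
  then show "lower s \<in> T" "lower s \<le> s"
    using closed_contains_Sup[OF S] by (auto simp: lower_def)
qed

lemma lower_ge: "t \<in> T \<Longrightarrow> t \<le> s \<Longrightarrow> t \<le> lower s"
  unfolding lower_def by (intro cSup_upper bdd_aboveI[of _ s]) auto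

lemma lower_eq: "t \<in> T \<Longrightarrow> lower t = t"
  using lower_le[of t] lower_ge[of t t] T_bounds by (simp add: antisym)

text \<open>Adaptedness of the density is assumed at right-scattered points only. These are exactly
  where \<open>interp\<close> needs it, as the slope matters only at times outside
  \<open>T\<close>.\<close>

lemma lower_right_scattered:
  assumes "0 \<le> s" "s \<le> 1" "s \<notin> T"
  shows "lower s \<in> right_scattered T"
proof -
  have less: "lower s < s"
    using lower_le[OF assms(1)] lower_T[OF assms(1)] assms(3) by (auto simp: order_le_less)
  have "s \<le> Inf {v \<in> T. v > lower s}"
  proof (rule cInf_greatest)
    show "{v \<in> T. v > lower s} \<noteq> {}" using one_T less assms by auto
    show "s \<le> v" if "v \<in> {v \<in> T. v > lower s}" for v
      using that lower_ge[of v s] by (cases "v \<le> s") auto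
  qed
  then show ?thesis
    using less lower_T[OF assms(1)] assms by (auto simp: right_scattered_def)
qed

text \<open>The element \<open>h\<close> of \<open>HT T\<close> is the restriction to \<open>T\<close> of the primitive of
  \<open>delta_density T h \<circ> rho_bar T\<close>, which is affine on the gaps of \<open>T\<close>; hence the value at \<open>s\<close> of
  this primitive only involves \<open>h\<close> and its density at the last point of \<open>T\<close> before \<open>s\<close>.\<close>

definition interp :: "(real \<Rightarrow> real) \<Rightarrow> real \<Rightarrow> real" where
  "interp h s = (if s < 0 then 0 else h (lower s) + (s - lower s) * delta_density T h (lower s))"

lemma interp_T: "t \<in> T \<Longrightarrow> interp h t = h t"
  using T_bounds[of t] by (simp add: interp_def lower_eq)

lemma interp_eq_primitive:
  assumes "h \<in> HT T"
  obtains G where "integrable lborel G" "integrable lborel (\<lambda>r. (G r)\<^sup>2)"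
    "(LINT r|lborel. (G r)\<^sup>2) = (HT_norm T h)\<^sup>2"
    "\<And>s. s \<le> 1 \<Longrightarrow> interp h s = (LINT r:{..s}|lborel. G r)"
proof -
  define g where "g = delta_density T h"
  have "has_delta_density T h g"
    using assms someI_ex[of "has_delta_density T h"] unfolding g_def delta_density_def HT_def by blast
  then have g [measurable]: "g \<in> borel_measurable (lambda_Delta T)"
    and g2: "integrable (lambda_Delta T) (\<lambda>s. (g s)\<^sup>2)"
    and h: "\<And>t. t \<in> T \<Longrightarrow> h t = (LINT s:{0..<t} \<inter> T|lambda_Delta T. g s)"
    by (auto simp: has_delta_density_def L2_Delta_def)
  define G where "G r = indicator {0..1} r * g (rho_bar T r)" for r :: real
  have G_sq: "(G r)\<^sup>2 = indicator {0..1} r * (g (rho_bar T r))\<^sup>2" for r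
    by (simp add: G_def indicator_def)
  have "g \<in> borel_measurable (restrict_space borel T)"
    using g by (simp add: lambda_Delta_def)
  from measurable_compose[OF rho_bar_measurable this]
  have G_meas: "G \<in> borel_measurable lborel"
    unfolding G_def by (subst (asm) borel_measurable_restrict_space_iff) (auto simp: mult.commute)
  have G2: "integrable lborel (\<lambda>r. (G r)\<^sup>2)"
    unfolding G_sq using g2 by (subst (asm) integrable_lambda_Delta) auto
  \<comment> \<open>On a bounded interval square integrability implies integrability, by
    \<open>\<bar>x\<bar> \<le> 1 + x\<^sup>2\<close>.\<close>
  have G: "integrable lborel G"
  proof (rule Bochner_Integration.integrable_bound)
    show "integrable lborel (\<lambda>r. indicator {0..1} r + (G r)\<^sup>2)"
      using G2 by (intro Bochner_Integration.integrable_add) auto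
    have "\<bar>x\<bar> \<le> 1 + x\<^sup>2" for x :: real
      using zero_le_power2[of "\<bar>x\<bar> - 1"] by (simp add: power2_diff)
    then show "AE r in lborel. norm (G r) \<le> norm (indicator {0..1} r + (G r)\<^sup>2)"
      by (intro AE_I2) (auto simp: G_def indicator_def)
  qed (rule G_meas)
  have norm: "(LINT r|lborel. (G r)\<^sup>2) = (HT_norm T h)\<^sup>2"
  proof -
    have "HT_inner T h h = (LINT s|lambda_Delta T. (g s)\<^sup>2)"
      by (simp add: HT_inner_def g_def power2_eq_square)
    also have "\<dots> = (LINT r|lborel. (G r)\<^sup>2)"
      unfolding G_sq by (rule integral_lambda_Delta) measurable
    finally have "HT_inner T h h = (LINT r|lborel. (G r)\<^sup>2)" .
    moreover have "0 \<le> (LINT r|lborel. (G r)\<^sup>2)" by (rule Bochner_Integration.integral_nonneg) simp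
    ultimately show ?thesis by (simp add: HT_norm_def)
  qed
  have h_eq: "h t = (LINT r:{..t}|lborel. G r)" if t: "t \<in> T" for t
  proof -
    have "{0..<t} \<inter> T \<in> sets (lambda_Delta T)"
      unfolding lambda_Delta_def by (auto simp: sets_restrict_space)
    then have "(\<lambda>x. indicator ({0..<t} \<inter> T) x * g x) \<in> borel_measurable (lambda_Delta T)"
      by measurable
    then have "h t = (LINT r|lborel. indicator {0..1} r * (indicator ({0..<t} \<inter> T) (rho_bar T r) * g (rho_bar T r)))"
      unfolding h[OF t] set_lebesgue_integral_def real_scaleR_def by (rule integral_lambda_Delta)
    also have "\<dots> = (LINT r|lborel. indicator {..t} r * G r)"
    proof (rule integral_cong_AE)
      \<comment> \<open>At \<open>r = t\<close> the two sides can differ, namely when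
        \<open>rho_bar T t = t\<close>; a single point is negligible.\<close>
      show "AE r in lborel. indicator {0..1} r * (indicator ({0..<t} \<inter> T) (rho_bar T r) * g (rho_bar T r)) = indicator {..t} r * G r"
        using AE_lborel_singleton[of t]
      proof eventually_elim
        case (elim r)
        show ?case
        proof (cases "r \<in> {0..1}")
          case True
          then have "rho_bar T r \<in> T" "rho_bar T r \<le> r" using rho_bar_T rho_bar_le by auto
          moreover have "t \<le> rho_bar T r" if "t < r" using rho_bar_ge[OF t that] .
          ultimately have "rho_bar T r \<in> {0..<t} \<inter> T \<longleftrightarrow> r \<in> {..t}"
            using elim T_bounds by force
          then show ?thesis by (simp add: G_def indicator_def)
        qed (simp add: G_def)
      qed
      have "(\<lambda>x. indicator ({0..<t} \<inter> T) x * g x) \<in> borel_measurable (restrict_space borel T)"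
        using \<open>(\<lambda>x. indicator ({0..<t} \<inter> T) x * g x) \<in> borel_measurable (lambda_Delta T)\<close>
        by (simp add: lambda_Delta_def)
      from measurable_compose[OF rho_bar_measurable this]
      show "(\<lambda>r. indicator {0..1} r * (indicator ({0..<t} \<inter> T) (rho_bar T r) * g (rho_bar T r))) \<in> borel_measurable lborel"
        by (subst (asm) borel_measurable_restrict_space_iff) (auto simp: mult.commute)
    qed (use G_meas in measurable)
    finally show ?thesis by (simp add: set_lebesgue_integral_def)
  qed
  have "interp h s = (LINT r:{..s}|lborel. G r)" if s: "s \<le> 1" for s
  proof (cases "s < 0")
    case True
    then have "(\<lambda>r. indicator {..s} r *\<^sub>R G r) = (\<lambda>_. 0)" by (auto simp: G_def indicator_def)
    then show ?thesis using True by (simp add: interp_def set_lebesgue_integral_def del: real_scaleR_def)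
  next
    case False
    define t where "t = lower s"
    have t: "t \<in> T" "t \<le> s" "0 \<le> t"
      using False lower_T[of s] lower_le[of s] T_bounds by (auto simp: t_def)
    have "{..s} = {..t} \<union> {t<..s}" using t by auto
    then have "(LINT r:{..s}|lborel. G r) = (LINT r:{..t}|lborel. G r) + (LINT r:{t<..s}|lborel. G r)"
      using G by (simp only:) (subst set_integral_Un; auto intro: integrable_imp_set_integrable)
    \<comment> \<open>No point of \<open>T\<close> lies in \<open>{t<..s}\<close>, so
      \<open>rho_bar T\<close> is constantly \<open>t\<close> there. For \<open>s\<close> in
      \<open>T\<close> the interval is empty.\<close>
    also have "(LINT r:{t<..s}|lborel. G r) = (LINT r:{t<..s}|lborel. g t)"
    proof (rule set_lebesgue_integral_cong)
      have "rho_bar T r = t" if r: "t < r" "r \<le> s" for r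
      proof (rule antisym)
        have "rho_bar T r \<le> s" using rho_bar_le[of r] r s t by auto
        then show "rho_bar T r \<le> t"
          unfolding t_def using rho_bar_T[of r] r s t by (intro lower_ge) auto
      qed (rule rho_bar_ge[OF t(1) r(1)])
      then show "\<forall>r. r \<in> {t<..s} \<longrightarrow> G r = g t" using t s by (auto simp: G_def)
    qed simp
    also have "\<dots> = (s - t) * g t"
      using t by (simp add: set_lebesgue_integral_def)
    finally show ?thesis
      using False h_eq[OF t(1)] by (simp add: interp_def t_def[symmetric] g_def)
  qed
  with G G2 norm show ?thesis by (rule that)
qed

text \<open>\<open>\<Phi>\<close> is the energy accumulated up to time \<open>s\<close>. Increments
  of a cumulative function telescope over any partition, delayed or not, so the total never exceeds
  the squared norm.\<close>

lemma interp_energy: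
  assumes "h \<in> HT T"
  obtains \<Phi> :: "real \<Rightarrow> real" where "\<And>s. 0 \<le> \<Phi> s" "\<And>s. \<Phi> s \<le> (HT_norm T h)\<^sup>2"
    "\<And>s t. s < t \<Longrightarrow> t \<le> 1 \<Longrightarrow> (interp h t - interp h s)\<^sup>2 \<le> (t - s) * (\<Phi> t - \<Phi> s)"
proof -
  obtain G where G: "integrable lborel G" "integrable lborel (\<lambda>r. (G r)\<^sup>2)"
    and norm: "(LINT r|lborel. (G r)\<^sup>2) = (HT_norm T h)\<^sup>2"
    and prim: "\<And>s. s \<le> 1 \<Longrightarrow> interp h s = (LINT r:{..s}|lborel. G r)"
    using interp_eq_primitive[OF assms] by blast
  define \<Phi> where "\<Phi> s = (LINT r:{..s}|lborel. (G r)\<^sup>2)" for s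
  have split: "(LINT r:{..t}|lborel. f r) - (LINT r:{..s}|lborel. f r) = (LINT r:{s<..t}|lborel. f r)"
    if "integrable lborel f" "s < t" for f :: "real \<Rightarrow> real" and s t :: real
  proof -
    have "{..t} = {..s} \<union> {s<..t}" using that by auto
    then have "(LINT r:{..t}|lborel. f r) = (LINT r:{..s}|lborel. f r) + (LINT r:{s<..t}|lborel. f r)"
      using that by (simp only:) (subst set_integral_Un; auto intro: integrable_imp_set_integrable)
    then show ?thesis by simp
  qed
  show ?thesis
  proof (rule that[of \<Phi>])
    show "0 \<le> \<Phi> s" for s
      unfolding \<Phi>_def set_lebesgue_integral_def by (rule Bochner_Integration.integral_nonneg) simp
    show "\<Phi> s \<le> (HT_norm T h)\<^sup>2" for s
      unfolding \<Phi>_def set_lebesgue_integral_def norm[symmetric] using G(2)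
      by (intro integral_mono integrable_mult_indicator) (auto simp: indicator_def)
    show "(interp h t - interp h s)\<^sup>2 \<le> (t - s) * (\<Phi> t - \<Phi> s)" if "s < t" "t \<le> 1" for s t
      using integral_Ioc_Cauchy_Schwarz[OF G that(1)] split[OF G(1) that(1)] split[OF G(2) that(1)] prim that
      by (simp add: \<Phi>_def)
  qed
qed

text \<open>By \<open>interp_energy\<close> the interpolation is Hoelder continuous of order 1/2, so
  a small delay costs little.\<close>

lemma interp_delay_tendsto:
  assumes "h \<in> HT T" "t \<in> T"
  shows "(\<lambda>n. interp h (t - 1 / real (Suc n))) \<longlonglongrightarrow> h t"
proof -
  obtain \<Phi> :: "real \<Rightarrow> real" where \<Phi>: "\<And>s. 0 \<le> \<Phi> s" "\<And>s. \<Phi> s \<le> (HT_norm T h)\<^sup>2"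
    "\<And>s t. s < t \<Longrightarrow> t \<le> 1 \<Longrightarrow> (interp h t - interp h s)\<^sup>2 \<le> (t - s) * (\<Phi> t - \<Phi> s)"
    using interp_energy[OF assms(1)] by blast
  let ?y = "\<lambda>n. (interp h t - interp h (t - 1 / real (Suc n)))\<^sup>2"
  have bound: "?y n \<le> 1 / real (Suc n) * (HT_norm T h)\<^sup>2" for n
  proof -
    have "?y n \<le> (1 / real (Suc n)) * (\<Phi> t - \<Phi> (t - 1 / real (Suc n)))"
      using \<Phi>(3)[of "t - 1 / real (Suc n)" t] T_bounds[OF assms(2)] by simp
    also have "\<dots> \<le> 1 / real (Suc n) * (HT_norm T h)\<^sup>2"
      using \<Phi>(1)[of "t - 1 / real (Suc n)"] \<Phi>(2)[of t] by (intro mult_left_mono) auto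
    finally show ?thesis .
  qed
  have lim0: "(\<lambda>n. 1 / real (Suc n)) \<longlonglongrightarrow> 0"
    using LIMSEQ_inverse_real_of_nat by (simp add: inverse_eq_divide)
  have "?y \<longlonglongrightarrow> 0"
    by (rule tendsto_sandwich[OF _ _ tendsto_const tendsto_mult_left_zero[OF lim0, of "(HT_norm T h)\<^sup>2"]])
       (use bound in auto)
  then have "(\<lambda>n. interp h t - interp h (t - 1 / real (Suc n))) \<longlonglongrightarrow> 0"
    by simp
  then show ?thesis
    using tendsto_diff[OF tendsto_const[of "interp h t"]] interp_T[OF assms(2), of h] by fastforce
qed

end

section \<open>Delayed drifts\<close>

lemma tendsto_coordinatewise:
  fixes f :: "'b \<Rightarrow> 'a \<Rightarrow> 'c :: topological_space"
  assumes "\<And>i. ((\<lambda>n. f n i) \<longlongrightarrow> l i) F"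
  shows "(f \<longlongrightarrow> l) F"
  using assms limitin_componentwise[of "\<lambda>_ :: 'a. euclidean :: 'c topology" UNIV f l F]
  by (simp add: euclidean_product_topology)

context time_scale
begin

text \<open>For each cell of length \<open>1 / N\<close> that meets \<open>T\<close>, its first and
  last point in \<open>T\<close> join the partition. If some \<open>c\<close> in \<open>T\<close>
  lies strictly between two neighbours, the ends for the cell of \<open>c\<close> enclose both
  neighbours, so their distance is at most \<open>1 / N\<close>.\<close>

lemma partition_exists:
  assumes R: "finite R" "R \<subseteq> T" and N: "0 < (N :: nat)"
  obtains p :: "nat \<Rightarrow> real" and m where "p 0 = 0" "\<And>i. i \<le> m \<Longrightarrow> p i \<in> T" "R \<subseteq> p ` {..m}"
    "\<And>i. i < m \<Longrightarrow> p i < p (Suc i)"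
    "\<And>i. i < m \<Longrightarrow> p (Suc i) - p i \<le> 1 / real N \<or> {p i<..<p (Suc i)} \<inter> T = {}"
proof -
  define C where "C j = T \<inter> {real j / real N..real (Suc j) / real N}" for j
  \<comment> \<open>The index \<open>j = N\<close> is included for the time 1, to which the floor
    below assigns this cell.\<close>
  define Q where "Q = R \<union> {0} \<union> (\<Union>j\<in>{j. j \<le> N \<and> C j \<noteq> {}}. {Inf (C j), Sup (C j)})"
  have bdd: "bdd_below (C j)" "bdd_above (C j)" for j
    unfolding C_def by (auto intro!: bdd_belowI[of _ 0] bdd_aboveI[of _ 1] simp: T_bounds)
  have C_bounds: "real j / real N \<le> x" "x \<le> real (Suc j) / real N" if "x \<in> C j" for x j
    using that by (auto simp: C_def)
  have C_closed: "closed (C j)" for j unfolding C_def using closed_T by auto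
  have C_ends: "Inf (C j) \<in> C j" "Sup (C j) \<in> C j" if "C j \<noteq> {}" for j
    using closed_contains_Inf[OF that bdd(1) C_closed] closed_contains_Sup[OF that bdd(2) C_closed] .
  have "C j \<subseteq> T" for j by (auto simp: C_def)
  then have "Inf (C j) \<in> T" "Sup (C j) \<in> T" if "C j \<noteq> {}" for j
    using C_ends[OF that] by blast+
  then have Q: "finite Q" "Q \<noteq> {}" "Q \<subseteq> T"
    using R zero_T by (auto simp: Q_def)
  obtain p m where p: "p ` {..m} = Q" "\<And>i. i < m \<Longrightarrow> p i < p (Suc i)"
    using finite_increasing_enumeration[OF Q(1,2)] by blast
  have p_less: "p i < p j" if "i < j" "j \<le> m" for i j
    using strict_increasing_initial[of m p i j] p(2) that by blast
  have p_T: "p i \<in> T" if "i \<le> m" for i using p(1) Q(3) that by blast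
  have p_below: "p k \<le> p i" if "k \<le> m" "i < m" "p k < p (Suc i)" for k i
  proof -
    have "k \<le> i"
    proof (rule ccontr)
      assume "\<not> k \<le> i"
      then consider "k = Suc i" | "Suc i < k" by linarith
      then show False using that p_less[of "Suc i" k] by cases auto
    qed
    then show ?thesis using p_less[of k i] that by (cases "k = i") auto
  qed
  have p_above: "p (Suc i) \<le> p k" if "k \<le> m" "i < m" "p i < p k" for k i
    using p_below[OF that(1,2)] that(3) by linarith
  have p0: "p 0 = 0"
  proof -
    have "0 \<in> p ` {..m}" unfolding p(1) by (simp add: Q_def)
    then obtain i where "i \<le> m" "p i = 0" by auto
    then show ?thesis using p_less[of 0 i] T_bounds(1)[OF p_T[of 0]] by (cases "i = 0") auto
  qed
  have gap: "p (Suc i) - p i \<le> 1 / real N" if i: "i < m" and c: "c \<in> T" "p i < c" "c < p (Suc i)" for i c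
  proof -
    define j where "j = nat \<lfloor>real N * c\<rfloor>"
    have "0 \<le> real N * c" "real N * c \<le> real N" using T_bounds[OF c(1)] by (auto simp: mult_left_le)
    then have j: "real j \<le> real N * c" "real N * c \<le> real (Suc j)" "j \<le> N"
      unfolding j_def by linarith+
    then have cC: "c \<in> C j"
      using c(1) N by (auto simp: C_def field_simps)
    then have "{Inf (C j), Sup (C j)} \<subseteq> p ` {..m}"
      unfolding p(1) Q_def using j(3) by blast
    then obtain k l where k: "k \<le> m" "p k = Inf (C j)" and l: "l \<le> m" "p l = Sup (C j)"
      by (auto simp: image_iff)
    have "Inf (C j) \<le> c" "c \<le> Sup (C j)" using cC bdd by (auto intro: cInf_lower cSup_upper)
    then have "p k \<le> p i" "p (Suc i) \<le> p l"
      using c k l i by (intro p_below p_above; simp)+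
    moreover have "Sup (C j) - Inf (C j) \<le> 1 / real N"
    proof -
      have "Sup (C j) \<le> real (Suc j) / real N" "real j / real N \<le> Inf (C j)"
        using C_bounds C_ends[of j] cC by blast+
      moreover have "real (Suc j) / real N - real j / real N = 1 / real N"
        by (simp add: diff_divide_distrib[symmetric])
      ultimately show ?thesis by linarith
    qed
    ultimately show ?thesis using k l by linarith
  qed
  show ?thesis
  proof (rule that[of p m])
    show "R \<subseteq> p ` {..m}" unfolding p(1) by (auto simp: Q_def)
    show "p (Suc i) - p i \<le> 1 / real N \<or> {p i<..<p (Suc i)} \<inter> T = {}" if "i < m" for i
      using gap[OF that] by fastforce
  qed (use p(2) p0 p_T in auto)
qed

text \<open>The delay makes the increment of the drift over each interval of a partition as above measurable
  at the left end point: the interval is a gap of \<open>T\<close>, where the drift is affine with slope known at that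
  point, or is no longer than the delay.\<close>

definition delayed :: "((real \<Rightarrow> real) \<Rightarrow> real \<Rightarrow> real) \<Rightarrow> nat \<Rightarrow> (real \<Rightarrow> real) \<Rightarrow> nat \<Rightarrow> real" where
  "delayed u n \<omega> = (\<lambda>i. if i < n then \<omega> (d i) + interp (u \<omega>) (d i - 1 / real (Suc n)) else 0)"

definition sampled :: "nat \<Rightarrow> (real \<Rightarrow> real) \<Rightarrow> nat \<Rightarrow> real" where
  "sampled n \<omega> = (\<lambda>i. if i < n then \<omega> (d i) else 0)"

lemma sampled_tendsto: "(\<lambda>n. sampled n \<omega>) \<longlonglongrightarrow> (\<lambda>i. \<omega> (d i))"
proof (rule tendsto_coordinatewise)
  fix i
  have "\<forall>\<^sub>F n in sequentially. sampled n \<omega> i = \<omega> (d i)"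
    using eventually_gt_at_top[of i] by eventually_elim (simp add: sampled_def)
  then show "(\<lambda>n. sampled n \<omega> i) \<longlonglongrightarrow> \<omega> (d i)" by (rule tendsto_eventually)
qed

lemma delayed_tendsto:
  assumes "u \<omega> \<in> HT T"
  shows "(\<lambda>n. delayed u n \<omega>) \<longlonglongrightarrow> (\<lambda>i. tau T u \<omega> (d i))"
proof (rule tendsto_coordinatewise)
  fix i
  have "\<forall>\<^sub>F n in sequentially. \<omega> (d i) + interp (u \<omega>) (d i - 1 / real (Suc n)) = delayed u n \<omega> i"
    using eventually_gt_at_top[of i] by eventually_elim (simp add: delayed_def)
  moreover have "(\<lambda>n. \<omega> (d i) + interp (u \<omega>) (d i - 1 / real (Suc n))) \<longlonglongrightarrow> \<omega> (d i) + u \<omega> (d i)"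
    by (intro tendsto_intros interp_delay_tendsto assms d_T)
  ultimately show "(\<lambda>n. delayed u n \<omega> i) \<longlonglongrightarrow> tau T u \<omega> (d i)"
    by (auto simp: tau_def d_T elim: Lim_transform_eventually)
qed

end

context sampled_wiener
begin

lemma measurable_filt_mono:
  assumes "s \<le> t" "f \<in> measurable (F s) K"
  shows "f \<in> measurable (F t) K"
proof (rule measurableI)
  show "f \<omega> \<in> space K" if "\<omega> \<in> space (F t)" for \<omega>
    using measurable_space[OF assms(2), of \<omega>] that by simp
  show "f -` A \<inter> space (F t) \<in> sets (F t)" if "A \<in> sets K" for A
    using measurable_sets[OF assms(2) that] sets_filt_mono[OF assms(1)] by auto
qed

text \<open>At a time in \<open>T\<close> the slope term vanishes and the value of \<open>u\<close>
  is adapted; elsewhere \<open>lower s\<close> is right-scattered and the slope is known there. The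
  guard in the bound on \<open>r\<close> excludes negative times, where \<open>interp\<close> is
  0.\<close>

lemma interp_adapted:
  assumes u: "u \<in> L2a_HT T \<mu>" and s: "s \<le> 1" and r: "0 \<le> s \<Longrightarrow> lower s \<le> r"
  shows "(\<lambda>\<omega>. interp (u \<omega>) s) \<in> borel_measurable (F r)"
proof (cases "s < 0")
  case False
  have adapted: "(\<lambda>\<omega>. u \<omega> (lower s)) \<in> borel_measurable (F (lower s))"
    using u lower_T[of s] False by (simp add: L2a_HT_def W_def)
  have "(\<lambda>\<omega>. interp (u \<omega>) s) \<in> borel_measurable (F (lower s))"
  proof (cases "s \<in> T")
    case True
    then show ?thesis using adapted False by (simp add: interp_def lower_eq)
  next
    case notin: False
    have "(\<lambda>\<omega>. delta_density T (u \<omega>) (lower s)) \<in> borel_measurable (F (lower s))"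
      using u lower_right_scattered[OF _ s notin] False by (simp add: L2a_HT_def)
    then show ?thesis
      unfolding interp_def using adapted False
      by (simp add: borel_measurable_add borel_measurable_times)
  qed
  then show ?thesis by (rule measurable_filt_mono[rotated]) (use r False in simp)
qed (simp add: interp_def)

text \<open>The three claims share one partition and the Gaussian structure on it, hence a single
  proof. The constants in both inequalities do not depend on \<open>n\<close>.\<close>

lemma
  assumes u: "u \<in> L2a_HT T \<mu>"
  shows delayed_measurable: "delayed u n \<in> borel_measurable \<mu>c"
    and delayed_le: "\<And>f C R \<delta>. f \<in> borel_measurable borel \<Longrightarrow> (\<And>x. 0 \<le> f x) \<Longrightarrow> (\<And>x. f x \<le> 1) \<Longrightarrow>
      (\<integral>\<^sup>+ \<omega>. ennreal ((HT_norm T (u \<omega>))\<^sup>2) \<partial>\<mu>) \<le> ennreal C \<Longrightarrow> 0 \<le> C \<Longrightarrow> 0 < R \<Longrightarrow> 0 < \<delta> \<Longrightarrow>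
      \<mu>c.expectation (\<lambda>\<omega>. f (delayed u n \<omega>)) \<le>
        C / R + \<delta> * exp R + \<mu>c.expectation (\<lambda>\<omega>. f (sampled n \<omega>)) / \<delta>"
    and le_delayed: "\<And>f C K. f \<in> borel_measurable borel \<Longrightarrow> (\<And>x. 0 \<le> f x) \<Longrightarrow> (\<And>x. f x \<le> 1) \<Longrightarrow>
      (AE \<omega> in \<mu>. (HT_norm T (u \<omega>))\<^sup>2 \<le> C) \<Longrightarrow> 0 < K \<Longrightarrow>
      \<mu>c.expectation (\<lambda>\<omega>. f (sampled n \<omega>)) \<le>
        exp C / K + K * \<mu>c.expectation (\<lambda>\<omega>. f (delayed u n \<omega>))"
proof -
  \<comment> \<open>The same number is the delay in \<open>delayed\<close> and the mesh for
    \<open>partition_exists\<close>, so an interval that is not a gap is no longer than the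
    delay.\<close>
  define \<eta> where "\<eta> = 1 / real (Suc n)"
  have \<eta>: "\<eta> > 0" by (simp add: \<eta>_def)
  obtain p m where p: "p 0 = 0" "\<And>i. i \<le> m \<Longrightarrow> p i \<in> T" "d ` {..<n} \<subseteq> p ` {..m}"
    "\<And>i. i < m \<Longrightarrow> p i < p (Suc i)"
    "\<And>i. i < m \<Longrightarrow> p (Suc i) - p i \<le> \<eta> \<or> {p i<..<p (Suc i)} \<inter> T = {}"
    using partition_exists[of "d ` {..<n}" "Suc n"] d_T unfolding \<eta>_def by blast
  have p_le: "p i \<le> p j" if "i \<le> j" "j \<le> m" for i j
    using strict_increasing_initial[of m p i j] p(4) that by (cases "i = j") auto
  define \<xi> where "\<xi> i \<omega> = \<omega> (p (Suc i)) - \<omega> (p i)" for i and \<omega> :: "real \<Rightarrow> real"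
  define a where "a i \<omega> = interp (u \<omega>) (p (Suc i) - \<eta>) - interp (u \<omega>) (p i - \<eta>)" for i \<omega>
  interpret I: gaussian_innovations \<mu>c "\<lambda>i. F (p i)" \<xi> "\<lambda>i. p (Suc i) - p i" m
  proof
    show "sets (F (p i)) \<subseteq> sets (F (p j))" if "i \<le> j" "j \<le> m" for i j
      using sets_filt_mono[OF p_le[OF that]] .
    show "\<xi> i \<in> borel_measurable (F (p (Suc i)))" if "i < m" for i
      unfolding \<xi>_def using that p_le[of i "Suc i"]
      by (intro borel_measurable_diff eval_filt p) auto
    show "distr \<mu>c (F (p i) \<Otimes>\<^sub>M borel) (\<lambda>\<omega>. (\<omega>, \<xi> i \<omega>)) =
        distr \<mu>c (F (p i)) (\<lambda>\<omega>. \<omega>) \<Otimes>\<^sub>M density lborel (normal_density 0 (sqrt (p (Suc i) - p i)))"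
      if "i < m" for i
      unfolding \<xi>_def using that by (intro innovation p) auto
  qed (use sets_filt_subset p in auto)
  have a_F: "a i \<in> borel_measurable (F (p i))" if i: "i < m" for i
  proof -
    have T: "p i \<in> T" "p (Suc i) \<in> T" using p(2) i by auto
    have "lower (p (Suc i) - \<eta>) \<le> p i" if nonneg: "0 \<le> p (Suc i) - \<eta>"
    proof (cases "p (Suc i) - p i \<le> \<eta>")
      case True
      then show ?thesis using lower_le[OF nonneg] by simp
    next
      case False
      then have "{p i<..<p (Suc i)} \<inter> T = {}" using p(5)[OF i] by simp
      moreover have "lower (p (Suc i) - \<eta>) < p (Suc i)" using lower_le[OF nonneg] \<eta> by simp
      ultimately show ?thesis using lower_T[OF nonneg] by force
    qed
    moreover have "lower (p i - \<eta>) \<le> p i" if "0 \<le> p i - \<eta>" using lower_le[OF that] \<eta> by simp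
    ultimately show ?thesis
      unfolding a_def using \<eta> T_bounds[OF T(1)] T_bounds[OF T(2)]
      by (intro borel_measurable_diff interp_adapted u) auto
  qed
  have energy: "AE \<omega> in \<mu>c. I.energy a m \<omega> \<le> (HT_norm T (u \<omega>))\<^sup>2"
  proof -
    have "AE \<omega> in \<mu>c. u \<omega> \<in> HT T"
      using u unfolding \<mu>c_def by (intro AE_completion) (simp add: L2a_HT_def L2_HT_def)
    then show ?thesis
    proof eventually_elim
      case (elim \<omega>)
      obtain \<Phi> :: "real \<Rightarrow> real" where \<Phi>: "\<And>s. 0 \<le> \<Phi> s" "\<And>s. \<Phi> s \<le> (HT_norm T (u \<omega>))\<^sup>2"
        "\<And>s t. s < t \<Longrightarrow> t \<le> 1 \<Longrightarrow> (interp (u \<omega>) t - interp (u \<omega>) s)\<^sup>2 \<le> (t - s) * (\<Phi> t - \<Phi> s)"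
        using interp_energy[OF elim] by blast
      \<comment> \<open>The accumulated energies at the delayed partition points telescope, so the
        bound is the same for every partition.\<close>
      have "I.energy a m \<omega> \<le> (\<Sum>i<m. \<Phi> (p (Suc i) - \<eta>) - \<Phi> (p i - \<eta>))"
        unfolding I.energy_def
      proof (rule sum_mono)
        fix i assume i: "i \<in> {..<m}"
        have pos: "0 < p (Suc i) - p i" using p(4)[of i] i by simp
        have "(a i \<omega>)\<^sup>2 \<le> (p (Suc i) - p i) * (\<Phi> (p (Suc i) - \<eta>) - \<Phi> (p i - \<eta>))"
          unfolding a_def using \<Phi>(3)[of "p i - \<eta>" "p (Suc i) - \<eta>"] pos \<eta> T_bounds[OF p(2)[of "Suc i"]] i
          by simp
        then show "(a i \<omega>)\<^sup>2 / (p (Suc i) - p i) \<le> \<Phi> (p (Suc i) - \<eta>) - \<Phi> (p i - \<eta>)"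
          using pos by (simp add: pos_divide_le_eq mult.commute)
      qed
      also have "\<dots> = \<Phi> (p m - \<eta>) - \<Phi> (p 0 - \<eta>)"
        by (rule sum_lessThan_telescope)
      also have "\<dots> \<le> (HT_norm T (u \<omega>))\<^sup>2"
        using \<Phi>(1)[of "p 0 - \<eta>"] \<Phi>(2)[of "p m - \<eta>"] by linarith
      finally show ?case .
    qed
  qed
  \<comment> \<open>\<open>\<kappa> i\<close> is the position of \<open>d i\<close> in the
    partition, and \<open>\<phi>\<close> sums increments back to path values, so test functions of
    sampled values become test functions of innovations.\<close>
  have "\<exists>j. j \<le> m \<and> p j = d i" if "i < n" for i
    using p(3) that by (force simp: image_iff)
  then obtain \<kappa> where \<kappa>: "\<And>i. i < n \<Longrightarrow> \<kappa> i \<le> m \<and> p (\<kappa> i) = d i" by metis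
  define \<phi> :: "(nat \<Rightarrow> real) \<Rightarrow> nat \<Rightarrow> real" where
    "\<phi> x = (\<lambda>i. if i < n then \<Sum>l<\<kappa> i. x l else 0)" for x
  have sum_\<xi>: "(\<Sum>l<\<kappa> i. \<xi> l \<omega>) = \<omega> (d i)" if "i < n" "\<omega> \<in> CT T" for i \<omega>
    using sum_lessThan_telescope[of "\<lambda>l. \<omega> (p l)" "\<kappa> i"] \<kappa>[OF that(1)] p(1) CT_zero[OF that(2)]
    by (simp add: \<xi>_def)
  \<comment> \<open>The telescoping sum starts from \<open>interp (u \<omega>) (- \<eta>)\<close>,
    which is 0 by the default of \<open>interp\<close> at negative times.\<close>
  have sum_a: "(\<Sum>l<\<kappa> i. a l \<omega>) = interp (u \<omega>) (d i - \<eta>)" if "i < n" for i \<omega>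
    using sum_lessThan_telescope[of "\<lambda>l. interp (u \<omega>) (p l - \<eta>)" "\<kappa> i"] \<kappa>[OF that] p(1) \<eta>
    by (simp add: a_def interp_def[of _ "- \<eta>"])
  have shifted_sum: "(\<Sum>l<\<kappa> i. I.shifted b m \<omega> l) = (\<Sum>l<\<kappa> i. \<xi> l \<omega>) + (\<Sum>l<\<kappa> i. b l \<omega>)"
    if "i < n" for b i \<omega>
    unfolding sum.distrib[symmetric] I.shifted_def using \<kappa>[OF that] by (intro sum.cong) auto
  have \<phi>_delayed: "\<phi> (I.shifted a m \<omega>) = delayed u n \<omega>" if "\<omega> \<in> CT T" for \<omega>
    using that sum_\<xi> sum_a by (auto simp: \<phi>_def delayed_def shifted_sum \<eta>_def)
  have \<phi>_sampled: "\<phi> (I.shifted (\<lambda>_ _. 0) m \<omega>) = sampled n \<omega>" if "\<omega> \<in> CT T" for \<omega>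
    using that sum_\<xi> by (auto simp: \<phi>_def sampled_def shifted_sum)
  have \<phi>_meas: "\<phi> \<in> borel_measurable borel"
  proof (rule measurable_coordinatewise_then_product)
    have "(\<lambda>x. x l) \<in> borel_measurable (borel :: (nat \<Rightarrow> real) measure)" for l
      by (rule measurable_product_then_coordinatewise) simp
    then show "(\<lambda>x. \<phi> x i) \<in> borel_measurable borel" for i
      unfolding \<phi>_def by (cases "i < n") auto
  qed
  have f\<phi>: "(\<lambda>x. f (\<phi> x)) \<in> borel_measurable borel" if "f \<in> borel_measurable borel" for f :: "(nat \<Rightarrow> real) \<Rightarrow> real"
    using \<phi>_meas that by (rule measurable_compose)
  have exp_delayed: "\<mu>c.expectation (\<lambda>\<omega>. f (\<phi> (I.shifted a m \<omega>))) = \<mu>c.expectation (\<lambda>\<omega>. f (delayed u n \<omega>))"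
    for f :: "(nat \<Rightarrow> real) \<Rightarrow> real"
    by (rule Bochner_Integration.integral_cong) (simp_all add: \<phi>_delayed)
  have exp_sampled: "\<mu>c.expectation (\<lambda>\<omega>. f (\<phi> (I.shifted (\<lambda>_ _. 0) m \<omega>))) = \<mu>c.expectation (\<lambda>\<omega>. f (sampled n \<omega>))"
    for f :: "(nat \<Rightarrow> real) \<Rightarrow> real"
    by (rule Bochner_Integration.integral_cong) (simp_all add: \<phi>_sampled)
  have "(\<lambda>\<omega>. \<phi> (I.shifted a m \<omega>)) \<in> borel_measurable \<mu>c"
  proof (rule measurable_compose[OF _ \<phi>_meas])
    show "I.shifted a m \<in> borel_measurable \<mu>c"
      by (rule I.measurable_G_N[OF order_refl I.shifted_measurable[OF a_F order_refl]])
  qed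
  then show "delayed u n \<in> borel_measurable \<mu>c"
    by (rule measurable_cong[THEN iffD1, rotated]) (simp add: \<phi>_delayed)
  show "\<mu>c.expectation (\<lambda>\<omega>. f (delayed u n \<omega>)) \<le>
        C / R + \<delta> * exp R + \<mu>c.expectation (\<lambda>\<omega>. f (sampled n \<omega>)) / \<delta>"
    if f: "f \<in> borel_measurable borel" "\<And>x. 0 \<le> f x" "\<And>x. f x \<le> 1"
      and that: "(\<integral>\<^sup>+ \<omega>. ennreal ((HT_norm T (u \<omega>))\<^sup>2) \<partial>\<mu>) \<le> ennreal C" "0 \<le> C" "0 < R" "0 < \<delta>"
    for f C R \<delta>
    unfolding exp_delayed[symmetric] exp_sampled[symmetric]
  proof (rule I.shifted_le[OF a_F f\<phi>[OF f(1)] f(2,3) _ that(2-4)])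
    have "(\<integral>\<^sup>+ \<omega>. ennreal (I.energy a m \<omega>) \<partial>\<mu>c) \<le> (\<integral>\<^sup>+ \<omega>. ennreal ((HT_norm T (u \<omega>))\<^sup>2) \<partial>\<mu>c)"
      using energy by (intro nn_integral_mono_AE) (auto elim: eventually_mono intro: ennreal_leI)
    also have "\<dots> \<le> ennreal C"
      unfolding \<mu>c_def nn_integral_completion by (rule that(1))
    finally show "(\<integral>\<^sup>+ \<omega>. ennreal (I.energy a m \<omega>) \<partial>\<mu>c) \<le> ennreal C" .
  qed auto
  show "\<mu>c.expectation (\<lambda>\<omega>. f (sampled n \<omega>)) \<le>
        exp C / K + K * \<mu>c.expectation (\<lambda>\<omega>. f (delayed u n \<omega>))"
    if f: "f \<in> borel_measurable borel" "\<And>x. 0 \<le> f x" "\<And>x. f x \<le> 1"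
      and that: "AE \<omega> in \<mu>. (HT_norm T (u \<omega>))\<^sup>2 \<le> C" "0 < K"
    for f C K
    unfolding exp_delayed[symmetric] exp_sampled[symmetric]
  proof (rule I.unshifted_le[OF a_F f\<phi>[OF f(1)] f(2,3) _ that(2)])
    have "AE \<omega> in \<mu>c. (HT_norm T (u \<omega>))\<^sup>2 \<le> C"
      using that(1) unfolding \<mu>c_def by (rule AE_completion)
    with energy show "AE \<omega> in \<mu>c. I.energy a m \<omega> \<le> C"
      by eventually_elim simp
  qed auto
qed

text \<open>By \<open>sets_borel_CT_obtain\<close> every null set of paths is the preimage of a
  Borel set of sequences that is null for the image law.\<close>

lemma absolutely_continuous_coordinates:
  assumes sets: "sets \<nu> = sets (borel_CT T)" "sets \<nu>' = sets (borel_CT T)"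
    and ac: "absolutely_continuous (distr \<nu> borel (\<lambda>\<omega> i. \<omega> (d i))) (distr \<nu>' borel (\<lambda>\<omega> i. \<omega> (d i)))"
  shows "absolutely_continuous \<nu> \<nu>'"
  unfolding absolutely_continuous_def
proof
  fix A assume A: "A \<in> null_sets \<nu>"
  then have "A \<in> sets (borel_CT T)" using sets by auto
  then obtain A' :: "(nat \<Rightarrow> real) set" where A': "A' \<in> sets borel" "A = (\<lambda>\<omega> i. \<omega> (d i)) -` A' \<inter> CT T"
    by (rule sets_borel_CT_obtain)
  have coord: "(\<lambda>\<omega> i. \<omega> (d i)) \<in> borel_measurable \<nu>" "(\<lambda>\<omega> i. \<omega> (d i)) \<in> borel_measurable \<nu>'"
    using measurable_coordinates sets by (simp_all cong: measurable_cong_sets)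
  have space: "space \<nu> = CT T" "space \<nu>' = CT T"
    using sets_eq_imp_space_eq[OF sets(1)] sets_eq_imp_space_eq[OF sets(2)] by simp_all
  have "A' \<in> null_sets (distr \<nu> borel (\<lambda>\<omega> i. \<omega> (d i)))"
    using A A' by (simp add: null_sets_distr_iff[OF coord(1)] space)
  then have "A' \<in> null_sets (distr \<nu>' borel (\<lambda>\<omega> i. \<omega> (d i)))"
    using ac by (auto simp: absolutely_continuous_def)
  then show "A \<in> null_sets \<nu>'"
    using A' by (simp add: null_sets_distr_iff[OF coord(2)] space)
qed

section \<open>Passage to the limit\<close>

context
  fixes u
  assumes u: "u \<in> L2a_HT T \<mu>"
begin

lemma tau_measurable: "tau T u \<in> measurable (borel_CT T) (borel_CT T)"
  using u by (intro measurable_tau) (simp add: L2a_HT_def L2_HT_def)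

text \<open>Completing \<open>\<mu>\<close> does not change image laws, so estimates obtained on
  \<open>\<mu>c\<close> become statements about \<open>\<mu>\<close>.\<close>

lemma distr_coordinates:
  "distr \<mu> borel (\<lambda>\<omega> i. \<omega> (d i)) = distr \<mu>c borel (\<lambda>\<omega> i. \<omega> (d i))"
  "distr (distr \<mu> (borel_CT T) (tau T u)) borel (\<lambda>\<omega> i. \<omega> (d i)) = distr \<mu>c borel (\<lambda>\<omega> i. tau T u \<omega> (d i))"
proof -
  have \<mu>: "(\<lambda>\<omega> i. \<omega> (d i)) \<in> borel_measurable \<mu>" "tau T u \<in> measurable \<mu> (borel_CT T)"
    using measurable_coordinates tau_measurable by (simp_all cong: measurable_cong_sets)
  show "distr \<mu> borel (\<lambda>\<omega> i. \<omega> (d i)) = distr \<mu>c borel (\<lambda>\<omega> i. \<omega> (d i))"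
    unfolding \<mu>c_def by (rule distr_completion[OF \<mu>(1), symmetric])
  have "distr (distr \<mu> (borel_CT T) (tau T u)) borel (\<lambda>\<omega> i. \<omega> (d i)) = distr \<mu> borel (\<lambda>\<omega> i. tau T u \<omega> (d i))"
    by (subst distr_distr[OF measurable_coordinates \<mu>(2)]) (simp add: comp_def)
  also have "\<dots> = distr \<mu>c borel (\<lambda>\<omega> i. tau T u \<omega> (d i))"
    unfolding \<mu>c_def
    by (rule distr_completion[symmetric], rule measurable_compose[OF \<mu>(2) measurable_coordinates])
  finally show "distr (distr \<mu> (borel_CT T) (tau T u)) borel (\<lambda>\<omega> i. \<omega> (d i)) = distr \<mu>c borel (\<lambda>\<omega> i. tau T u \<omega> (d i))" .
qed

text \<open>Dominated convergence with bound 1, using continuity of \<open>f\<close> for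
  coordinatewise convergence. The delayed paths converge only almost surely, namely where
  \<open>u \<omega>\<close> lies in \<open>HT T\<close>.\<close>

lemma
  fixes f :: "(nat \<Rightarrow> real) \<Rightarrow> real"
  assumes f: "continuous_on UNIV f" "\<And>x. 0 \<le> f x" "\<And>x. f x \<le> 1"
  shows delayed_expectation_tendsto:
      "(\<lambda>n. \<mu>c.expectation (\<lambda>\<omega>. f (delayed u n \<omega>))) \<longlonglongrightarrow> (LINT x|distr \<mu>c borel (\<lambda>\<omega> i. tau T u \<omega> (d i)). f x)"
    and sampled_expectation_tendsto:
      "(\<lambda>n. \<mu>c.expectation (\<lambda>\<omega>. f (sampled n \<omega>))) \<longlonglongrightarrow> (LINT x|distr \<mu>c borel (\<lambda>\<omega> i. \<omega> (d i)). f x)"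
proof -
  have f_meas: "f \<in> borel_measurable borel" by (rule borel_measurable_continuous_onI[OF f(1)])
  have f_lim: "(\<lambda>n. f (x n)) \<longlonglongrightarrow> f l" if "x \<longlonglongrightarrow> l" for x l
    by (rule continuous_on_tendsto_compose[OF f(1) that]) auto
  have tau_meas: "(\<lambda>\<omega> i. tau T u \<omega> (d i)) \<in> borel_measurable \<mu>c"
    by (rule measurable_\<mu>_\<mu>c[OF measurable_compose[OF tau_measurable measurable_coordinates]])
  have id_meas: "(\<lambda>\<omega> i. \<omega> (d i)) \<in> borel_measurable \<mu>c"
    by (rule measurable_\<mu>_\<mu>c[OF measurable_coordinates])
  have sampled_meas: "sampled n \<in> borel_measurable \<mu>c" for n
    unfolding sampled_def
  proof (rule measurable_coordinatewise_then_product)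
    show "(\<lambda>\<omega>. if i < n then \<omega> (d i) else 0) \<in> borel_measurable \<mu>c" for i
      using measurable_\<mu>_\<mu>c[OF measurable_eval[OF d_T]] by (cases "i < n") auto
  qed
  have HT: "AE \<omega> in \<mu>c. u \<omega> \<in> HT T"
    using u unfolding \<mu>c_def by (intro AE_completion) (simp add: L2a_HT_def L2_HT_def)
  have "(\<lambda>n. \<mu>c.expectation (\<lambda>\<omega>. f (delayed u n \<omega>))) \<longlonglongrightarrow> \<mu>c.expectation (\<lambda>\<omega>. f (\<lambda>i. tau T u \<omega> (d i)))"
  proof (rule integral_dominated_convergence[where w = "\<lambda>_. 1"])
    show "(\<lambda>\<omega>. f (delayed u n \<omega>)) \<in> borel_measurable \<mu>c" for n
      using measurable_compose[OF delayed_measurable[OF u] f_meas] .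
    show "(\<lambda>\<omega>. f (\<lambda>i. tau T u \<omega> (d i))) \<in> borel_measurable \<mu>c"
      using measurable_compose[OF tau_meas f_meas] .
    show "AE \<omega> in \<mu>c. (\<lambda>n. f (delayed u n \<omega>)) \<longlonglongrightarrow> f (\<lambda>i. tau T u \<omega> (d i))"
      using HT by eventually_elim (intro f_lim delayed_tendsto)
  qed (use f in auto)
  then show "(\<lambda>n. \<mu>c.expectation (\<lambda>\<omega>. f (delayed u n \<omega>))) \<longlonglongrightarrow> (LINT x|distr \<mu>c borel (\<lambda>\<omega> i. tau T u \<omega> (d i)). f x)"
    by (simp add: integral_distr[OF tau_meas f_meas])
  have "(\<lambda>n. \<mu>c.expectation (\<lambda>\<omega>. f (sampled n \<omega>))) \<longlonglongrightarrow> \<mu>c.expectation (\<lambda>\<omega>. f (\<lambda>i. \<omega> (d i)))"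
  proof (rule integral_dominated_convergence[where w = "\<lambda>_. 1"])
    show "(\<lambda>\<omega>. f (sampled n \<omega>)) \<in> borel_measurable \<mu>c" for n
      using measurable_compose[OF sampled_meas f_meas] .
    show "(\<lambda>\<omega>. f (\<lambda>i. \<omega> (d i))) \<in> borel_measurable \<mu>c"
      using measurable_compose[OF id_meas f_meas] .
    show "AE \<omega> in \<mu>c. (\<lambda>n. f (sampled n \<omega>)) \<longlonglongrightarrow> f (\<lambda>i. \<omega> (d i))"
      by (intro AE_I2 f_lim sampled_tendsto)
  qed (use f in auto)
  then show "(\<lambda>n. \<mu>c.expectation (\<lambda>\<omega>. f (sampled n \<omega>))) \<longlonglongrightarrow> (LINT x|distr \<mu>c borel (\<lambda>\<omega> i. \<omega> (d i)). f x)"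
    by (simp add: integral_distr[OF id_meas f_meas])
qed

lemma finite_measure_coordinates:
  "finite_measure (distr \<mu>c borel (\<lambda>\<omega> i. \<omega> (d i)))"
  "finite_measure (distr \<mu>c borel (\<lambda>\<omega> i. tau T u \<omega> (d i)))"
  using \<mu>c.finite_measure_distr measurable_\<mu>_\<mu>c[OF measurable_coordinates]
    measurable_\<mu>_\<mu>c[OF measurable_compose[OF tau_measurable measurable_coordinates]] by auto

lemma absolutely_continuous_distr_tau: "absolutely_continuous \<mu> (distr \<mu> (borel_CT T) (tau T u))"
proof (rule absolutely_continuous_coordinates)
  let ?E = "\<integral>\<^sup>+ \<omega>. ennreal ((HT_norm T (u \<omega>))\<^sup>2) \<partial>\<mu>"
  obtain C where C: "0 \<le> C" "?E \<le> ennreal C"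
    using u by (cases ?E) (auto simp: L2a_HT_def L2_HT_def)
  show "absolutely_continuous (distr \<mu> borel (\<lambda>\<omega> i. \<omega> (d i)))
     (distr (distr \<mu> (borel_CT T) (tau T u)) borel (\<lambda>\<omega> i. \<omega> (d i)))"
    unfolding distr_coordinates
  proof (rule absolutely_continuous_if_continuous_functions_dominated)
    fix e :: real assume e: "e > 0"
    \<comment> \<open>\<open>R\<close> makes the Markov term \<open>C / R\<close> at most
      \<open>e / 2\<close>, with \<open>+ 1\<close> for the case \<open>C = 0\<close>; then \<delta>
      makes \<open>\<delta> * exp R\<close> equal to \<open>e / 2\<close>. Neither involves
      \<open>n\<close> or \<open>f\<close>.\<close>
    define R where "R = 2 * (C + 1) / e"
    define \<delta> where "\<delta> = e / (2 * exp R)"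
    have R: "0 < R" and \<delta>: "0 < \<delta>" using e C by (auto simp: R_def \<delta>_def)
    have "C / R + \<delta> * exp R \<le> e"
      using e C by (simp add: R_def \<delta>_def field_simps)
    show "\<exists>K\<ge>0. \<forall>f. continuous_on UNIV f \<and> (\<forall>x. 0 \<le> f x \<and> f x \<le> 1) \<longrightarrow>
        (LINT x|distr \<mu>c borel (\<lambda>\<omega> i. tau T u \<omega> (d i)). f x) \<le> e + K * (LINT x|distr \<mu>c borel (\<lambda>\<omega> i. \<omega> (d i)). f x)"
    proof (intro exI[of _ "1 / \<delta>"] conjI allI impI)
      fix f :: "(nat \<Rightarrow> real) \<Rightarrow> real" assume "continuous_on UNIV f \<and> (\<forall>x. 0 \<le> f x \<and> f x \<le> 1)"
      then have f: "continuous_on UNIV f" "\<And>x. 0 \<le> f x" "\<And>x. f x \<le> 1" by auto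
      show "(LINT x|distr \<mu>c borel (\<lambda>\<omega> i. tau T u \<omega> (d i)). f x) \<le> e + 1 / \<delta> * (LINT x|distr \<mu>c borel (\<lambda>\<omega> i. \<omega> (d i)). f x)"
      proof (rule LIMSEQ_le[OF delayed_expectation_tendsto[OF f]
            tendsto_add[OF tendsto_const tendsto_mult[OF tendsto_const sampled_expectation_tendsto[OF f]]]], intro exI[of _ 0] allI impI)
        fix n
        show "\<mu>c.expectation (\<lambda>\<omega>. f (delayed u n \<omega>)) \<le> e + 1 / \<delta> * \<mu>c.expectation (\<lambda>\<omega>. f (sampled n \<omega>))"
          using delayed_le[OF u borel_measurable_continuous_onI[OF f(1)] f(2,3) C(2,1) R \<delta>, of n] \<open>C / R + \<delta> * exp R \<le> e\<close>
          by simp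
      qed
    qed (use \<delta> in auto)
  qed (use finite_measure_coordinates in auto)
qed auto

lemma distr_tau_absolutely_continuous:
  assumes "AE \<omega> in \<mu>. (HT_norm T (u \<omega>))\<^sup>2 \<le> C"
  shows "absolutely_continuous (distr \<mu> (borel_CT T) (tau T u)) \<mu>"
proof (rule absolutely_continuous_coordinates)
  show "absolutely_continuous (distr (distr \<mu> (borel_CT T) (tau T u)) borel (\<lambda>\<omega> i. \<omega> (d i)))
     (distr \<mu> borel (\<lambda>\<omega> i. \<omega> (d i)))"
    unfolding distr_coordinates
  proof (rule absolutely_continuous_if_continuous_functions_dominated)
    fix e :: real assume e: "e > 0"
    \<comment> \<open>Chosen so that the error term \<open>exp C / K\<close> is exactly
      \<open>e\<close>.\<close>
    define K where "K = exp C / e"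
    have K: "0 < K" "exp C / K = e" using e by (auto simp: K_def)
    show "\<exists>K\<ge>0. \<forall>f. continuous_on UNIV f \<and> (\<forall>x. 0 \<le> f x \<and> f x \<le> 1) \<longrightarrow>
        (LINT x|distr \<mu>c borel (\<lambda>\<omega> i. \<omega> (d i)). f x) \<le> e + K * (LINT x|distr \<mu>c borel (\<lambda>\<omega> i. tau T u \<omega> (d i)). f x)"
    proof (intro exI[of _ K] conjI allI impI)
      fix f :: "(nat \<Rightarrow> real) \<Rightarrow> real" assume "continuous_on UNIV f \<and> (\<forall>x. 0 \<le> f x \<and> f x \<le> 1)"
      then have f: "continuous_on UNIV f" "\<And>x. 0 \<le> f x" "\<And>x. f x \<le> 1" by auto
      show "(LINT x|distr \<mu>c borel (\<lambda>\<omega> i. \<omega> (d i)). f x) \<le> e + K * (LINT x|distr \<mu>c borel (\<lambda>\<omega> i. tau T u \<omega> (d i)). f x)"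
      proof (rule LIMSEQ_le[OF sampled_expectation_tendsto[OF f]
            tendsto_add[OF tendsto_const tendsto_mult[OF tendsto_const delayed_expectation_tendsto[OF f]]]], intro exI[of _ 0] allI impI)
        fix n
        show "\<mu>c.expectation (\<lambda>\<omega>. f (sampled n \<omega>)) \<le> e + K * \<mu>c.expectation (\<lambda>\<omega>. f (delayed u n \<omega>))"
          using le_delayed[OF u borel_measurable_continuous_onI[OF f(1)] f(2,3) assms K(1), of n] K(2) by simp
      qed
    qed (use K in auto)
  qed (use finite_measure_coordinates in auto)
qed auto

end

end

theorem lemma4p2:
  fixes T :: "real set" and M :: "'a measure" and B :: "real \<Rightarrow> 'a \<Rightarrow> real"
    and \<mu> :: "(real \<Rightarrow> real) measure"
  assumes "closed T" and "{0, 1} \<subseteq> T" and "T \<subseteq> {0..1}"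
    and "standard_brownian_motion M B"
    and "\<mu> = sampled_law T M B"
  shows "(\<forall>u \<in> L2a_HT T \<mu>. absolutely_continuous \<mu> (distr \<mu> (borel_CT T) (tau T u))) \<and>
         (\<forall>u \<in> Linfa_HT T \<mu>. absolutely_continuous \<mu> (distr \<mu> (borel_CT T) (tau T u)) \<and>
                              absolutely_continuous (distr \<mu> (borel_CT T) (tau T u)) \<mu>)"
proof -
  obtain D where D: "countable D" "D \<subseteq> T" "T \<subseteq> closure D"
    using separable[of T] by blast
  have "D \<noteq> {}" using D(3) assms(2) by auto
  \<comment> \<open>For finite \<open>D\<close> the enumeration repeats points, so one sequence
    serves finite and infinite \<open>T\<close> alike.\<close>
  have range: "range (from_nat_into D) = D"
    using \<open>D \<noteq> {}\<close> D(1) by (rule range_from_nat_into)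
  interpret sampled_wiener T "from_nat_into D" M B
  proof
    show "from_nat_into D i \<in> T" for i using from_nat_into[OF \<open>D \<noteq> {}\<close>] D(2) by blast
  qed (use assms D range in auto)
  have \<mu>: "local.\<mu> = \<mu>" by (simp add: \<mu>_def assms(5))
  show ?thesis
  proof (intro conjI ballI)
    fix u assume "u \<in> L2a_HT T \<mu>"
    then show "absolutely_continuous \<mu> (distr \<mu> (borel_CT T) (tau T u))"
      using absolutely_continuous_distr_tau[of u] by (simp add: \<mu>)
  next
    fix u assume u: "u \<in> Linfa_HT T \<mu>"
    then have L2: "u \<in> L2a_HT T \<mu>" by (simp add: Linfa_HT_def)
    then show "absolutely_continuous \<mu> (distr \<mu> (borel_CT T) (tau T u))"
      using absolutely_continuous_distr_tau[of u] by (simp add: \<mu>)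
    obtain c where "c > 0" and c: "AE \<omega> in \<mu>. HT_norm T (u \<omega>) < c"
      using u by (auto simp: Linfa_HT_def)
    have nonneg: "0 \<le> HT_norm T h" for h
      unfolding HT_norm_def HT_inner_def
      by (intro real_sqrt_ge_zero Bochner_Integration.integral_nonneg) simp
    have "AE \<omega> in \<mu>. (HT_norm T (u \<omega>))\<^sup>2 \<le> c\<^sup>2"
      using c by eventually_elim (simp add: power_mono nonneg)
    then show "absolutely_continuous (distr \<mu> (borel_CT T) (tau T u)) \<mu>"
      using distr_tau_absolutely_continuous[of u "c\<^sup>2", unfolded \<mu>] L2 by blast
  qed
qed

end
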